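(* For a composition $\alpha$ let $\mathbf{H}_\alpha^q=\sum_{\beta} q^{c(\alpha,\beta^c)}\,\mathbf{s}_\beta$, where the sum is over all compositions $\beta$ of $|\alpha|$ such that $\alpha\le\beta$. Then $$\mathbf{H}_\alpha^q=\widetilde{A_{\alpha_{\ell(\alpha)}}}^q\,\widetilde{A_{\alpha_{\ell(\alpha)-1}}}^q\cdots\widetilde{A_{\alpha_1}}^q\,1 ,$$ where $\widetilde{A_{m}}^q$ is the $q$-analog of the operator $A_{(m)}$ which appends a part $m$ to the index of a ribbon Schur function.
   Context: A composition $\alpha$ of a positive integer $n$ ($\alpha\models n$) is a sequence $(\alpha_1,\dots,\alpha_\ell)$ of positive integers with sum $n$; $|\alpha|=n$, $\ell(\alpha)=\ell$. Concatenation: $\alpha\cdot\beta=(\alpha_1,\dots,\alpha_{\ell(\alpha)},\beta_1,\dots,\beta_{\ell(\beta)})$. The descent set is $D(\alpha)=\{\alpha_1,\alpha_1+\alpha_2,\dots,\alpha_1+\cdots+\alpha_{\ell-1}\}\subseteq\{1,\dots,n-1\}$; $\alpha\mapsto D(\alpha)$ is a bijection onto subsets of $\{1,\dots,n-1\}$. For compositions of the same $n$, $\alpha\le\beta$ means $D(\beta)\subseteq D(\alpha)$. The composition $\alpha^c$ is defined by $D(\alpha^c)=\{1,\dots,n-1\}\setminus D(\alpha)$. For $\alpha,\beta\models n$, $c(\alpha,\beta)=\sum_{i\in D(\alpha)\cap D(\beta)} i$. $NC\Lambda$ is the free associative algebra on $\mathbf{h}_1,\mathbf{h}_2,\dots$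 over $\mathbb{Q}$, with coefficients extended to $\mathbb{Q}(q)$, graded by $\deg\mathbf{h}_k=k$. Put $\mathbf{h}_\alpha=\mathbf{h}_{\alpha_1}\cdots\mathbf{h}_{\alpha_\ell}$. The ribbon Schur functions $\mathbf{s}_\alpha=\sum_{\beta\ge\alpha}(-1)^{\ell(\alpha)-\ell(\beta)}\mathbf{h}_\beta$, together with $\mathbf{s}_\emptyset=1$, form a basis. $NC\Lambda$ is a graded co-commutative Hopf algebra with comultiplication $\Delta$ the algebra homomorphism given by $\Delta(\mathbf{h}_k)=\sum_{i=0}^k\mathbf{h}_i\otimes\mathbf{h}_{k-i}$ ($\mathbf{h}_0=1$), the usual unit and counit, multiplication $\mu$, and antipode $S$. For linear $V:NC\Lambda\to NC\Lambda$ put $\overline{V}=\mu\circ(\mathrm{id}\otimes (V\circ S))\circ\Delta$. Let $R^q$ be the linear operator with $R^q(f)=q^{\deg f}f$ for homogeneous $f$. The $q$-analog of $V$ is $\widetilde{V}^q=\overline{\overline{V}\circ\overline{R^q}}$ (the bar operation applied to the composite of $\overline V$ and $\overline{R^q}$). For a composition $\alpha$, $A_\alpha$ is the linear operator on $NC\Lambda$ with $A_\alpha(\mathbf{s}_\beta)=\mathbf{s}_{\beta\cdot\alpha}$ (so $A_\alpha(1)=\mathbf{s}_\alpha$), and $\widetilde{A_\alpha}^q$ is its $q$-analog; $\widetilde{A_m}^q$ means $\widetilde{A_{(m)}}^q$ for the one-part composition $(m)$. *)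

theory Defs
  imports
    "HOL-Library.Poly_Mapping"
    "HOL-Library.Product_Plus"
    "HOL-Computational_Algebra.Polynomial"
    "HOL-Computational_Algebra.Fraction_Field"
    "HOL-Computational_Algebra.Formal_Power_Series"
begin

section \<open>Compositions\<close>

text \<open>The empty composition is included; it is the neutral element of concatenation.\<close>

typedef composition = "{xs :: nat list. 0 \<notin> set xs}"
  morphisms parts Composition
  by (intro exI[of _ "[]"]) simp

instantiation composition :: monoid_add
begin

definition "0 = Composition []"

definition "\<alpha> + \<beta> = Composition (parts \<alpha> @ parts \<beta>)"

lemma parts_zero: "parts 0 = []"
  by (simp add: zero_composition_def Composition_inverse)

lemma parts_plus: "parts (\<alpha> + \<beta>) = parts \<alpha> @ parts \<beta>"
  using parts[of \<alpha>] parts[of \<beta>] by (simp add: plus_composition_def Composition_inverse)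

instance
  by standard (simp_all add: parts_zero parts_plus flip: parts_inject)

end

declare parts_zero [simp] parts_plus [simp]

definition csize :: "composition \<Rightarrow> nat" where
  "csize \<alpha> = sum_list (parts \<alpha>)"

definition clength :: "composition \<Rightarrow> nat" where
  "clength \<alpha> = length (parts \<alpha>)"

text \<open>Only meaningful for \<open>m > 0\<close>.\<close>

definition one_part :: "nat \<Rightarrow> composition" where
  "one_part m = Composition [m]"

definition list_descents :: "nat list \<Rightarrow> nat set" where
  "list_descents xs = {sum_list (take i xs) | i. 0 < i \<and> i < length xs}"

definition descents :: "composition \<Rightarrow> nat set" where
  "descents \<alpha> = list_descents (parts \<alpha>)"

lemma parts_nonzero: "0 \<notin> set (parts \<alpha>)"
  using parts[of \<alpha>] by simp

lemma parts_Composition: "0 \<notin> set xs \<Longrightarrow> parts (Composition xs) = xs"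
  by (simp add: Composition_inverse)

lemma parts_one_part: "m > 0 \<Longrightarrow> parts (one_part m) = [m]"
  by (simp add: one_part_def parts_Composition)

lemma csize_zero [simp]: "csize 0 = 0"
  by (simp add: csize_def)

lemma csize_plus [simp]: "csize (\<alpha> + \<beta>) = csize \<alpha> + csize \<beta>"
  by (simp add: csize_def)

lemma csize_eq_0_iff [simp]: "csize \<alpha> = 0 \<longleftrightarrow> \<alpha> = 0"
proof -
  have "csize \<alpha> = 0 \<longleftrightarrow> parts \<alpha> = []"
    using parts_nonzero[of \<alpha>] by (cases "parts \<alpha>") (auto simp: csize_def)
  then show ?thesis
    by (metis parts_inject parts_zero)
qed

lemma csize_one_part: "m > 0 \<Longrightarrow> csize (one_part m) = m"
  by (simp add: csize_def parts_one_part)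

lemma list_descents_Nil [simp]: "list_descents [] = {}"
  and list_descents_single [simp]: "list_descents [x] = {}"
  by (auto simp: list_descents_def)

lemma list_descents_Cons:
  assumes "xs \<noteq> []"
  shows "list_descents (x # xs) = insert x ((+) x ` list_descents xs)"
proof (intro equalityI subsetI)
  fix a assume "a \<in> list_descents (x # xs)"
  then obtain i where i: "0 < i" "i < Suc (length xs)" "a = sum_list (take i (x # xs))"
    by (auto simp: list_descents_def)
  then obtain j where j: "i = Suc j" by (cases i) auto
  show "a \<in> insert x ((+) x ` list_descents xs)"
    using i j by (cases "j = 0") (auto simp: list_descents_def)
next
  fix a assume "a \<in> insert x ((+) x ` list_descents xs)"
  then show "a \<in> list_descents (x # xs)"
  proof
    assume "a = x"
    then show ?thesis
      using assms by (auto simp: list_descents_def intro!: exI[of _ 1])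
  next
    assume "a \<in> (+) x ` list_descents xs"
    then obtain i where "0 < i" "i < length xs" "a = x + sum_list (take i xs)"
      by (auto simp: list_descents_def)
    then show ?thesis
      by (auto simp: list_descents_def intro!: exI[of _ "Suc i"])
  qed
qed

lemma list_descents_bounds:
  assumes "0 \<notin> set xs" "a \<in> list_descents xs"
  shows "0 < a \<and> a < sum_list xs"
  using assms
proof (induction xs arbitrary: a)
  case (Cons x xs)
  show ?case
  proof (cases "xs = []")
    case False
    then have "sum_list xs > 0" using Cons.prems(1) by (cases xs) auto
    then show ?thesis using Cons False by (auto simp: list_descents_Cons)
  qed (use Cons in simp)
qed simp

lemma descents_subset: "descents \<alpha> \<subseteq> {1..<csize \<alpha>}"
  using list_descents_bounds[OF parts_nonzero, of _ \<alpha>]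
  by (force simp: descents_def csize_def)

lemma finite_descents [simp]: "finite (descents \<alpha>)"
  by (rule finite_subset[OF descents_subset]) simp

lemma list_descents_inject:
  assumes "0 \<notin> set xs" "0 \<notin> set ys" "sum_list xs = sum_list ys"
    "list_descents xs = list_descents ys"
  shows "xs = ys"
  using assms
proof (induction xs arbitrary: ys)
  case Nil
  then show ?case by (cases ys) auto
next
  case (Cons x xs)
  obtain y zs where ys: "ys = y # zs" using Cons.prems by (cases ys) auto
  show ?case
  proof (cases "xs = [] \<or> zs = []")
    case True
    then have "xs = [] \<and> zs = []"
      using Cons.prems(4) ys list_descents_Cons[of xs x] list_descents_Cons[of zs y]
      by (cases "xs = []"; cases "zs = []") auto
    then show ?thesis using Cons.prems ys by simp
  next
    case False
    have eq: "insert x ((+) x ` list_descents xs) = insert y ((+) y ` list_descents zs)"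
      using Cons.prems(4) ys False by (simp add: list_descents_Cons)
    have pos: "a > 0" if "a \<in> list_descents xs \<or> a \<in> list_descents zs" for a
      using that list_descents_bounds[of xs a] list_descents_bounds[of zs a] Cons.prems(1,2) ys
      by auto
    have "x \<in> insert y ((+) y ` list_descents zs)" "y \<in> insert x ((+) x ` list_descents xs)"
      using eq by auto
    then have xy: "x = y" by auto
    have nx: "x \<notin> (+) x ` list_descents xs" "x \<notin> (+) x ` list_descents zs"
      using pos[of 0] by auto
    have "(+) x ` list_descents xs = (+) x ` list_descents zs"
      using eq xy nx by (metis insert_ident)
    then have "list_descents xs = list_descents zs"
      by (simp add: inj_image_eq_iff)
    then show ?thesis using Cons.IH[of zs] Cons.prems ys xy by simp
  qed
qed

lemma list_descents_surj:
  assumes "A \<subseteq> {1..<n}"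
  shows "\<exists>xs. 0 \<notin> set xs \<and> sum_list xs = n \<and> list_descents xs = A"
  using assms
proof (induction n arbitrary: A rule: less_induct)
  case (less n)
  show ?case
  proof (cases "A = {}")
    case True
    then show ?thesis
      by (cases "n = 0") (auto intro: exI[of _ "[]"] exI[of _ "[n]"])
  next
    case False
    have fin: "finite A" using less.prems finite_subset by blast
    define m where "m = Min A"
    have mA: "m \<in> A" and mmin: "\<And>a. a \<in> A \<Longrightarrow> m \<le> a"
      using fin False by (auto simp: m_def)
    have m: "0 < m" "m < n" using mA less.prems by auto
    define B where "B = (\<lambda>a. a - m) ` (A - {m})"
    have "B \<subseteq> {1..<n - m}"
    proof
      fix b assume "b \<in> B"
      then obtain a where a: "a \<in> A" "a \<noteq> m" "b = a - m" by (auto simp: B_def)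
      then have "m < a" "a < n" using mmin[of a] less.prems by auto
      then show "b \<in> {1..<n - m}" using a by auto
    qed
    then obtain xs where xs: "0 \<notin> set xs" "sum_list xs = n - m" "list_descents xs = B"
      using less.IH[of "n - m" B] m by auto
    have "xs \<noteq> []" using xs m by auto
    moreover have "(+) m ` B = A - {m}"
      unfolding B_def image_image using mmin by (force simp: image_iff)
    ultimately have "list_descents (m # xs) = A"
      using xs mA by (auto simp: list_descents_Cons)
    then show ?thesis using xs m by (intro exI[of _ "m # xs"]) auto
  qed
qed

lemma composition_eqI: "csize \<alpha> = csize \<beta> \<Longrightarrow> descents \<alpha> = descents \<beta> \<Longrightarrow> \<alpha> = \<beta>"
  using list_descents_inject[OF parts_nonzero parts_nonzero]
  by (simp add: csize_def descents_def flip: parts_inject)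

lemma ex1_composition:
  assumes "A \<subseteq> {1..<n}"
  shows "\<exists>!\<alpha>. csize \<alpha> = n \<and> descents \<alpha> = A"
proof -
  obtain xs where xs: "0 \<notin> set xs" "sum_list xs = n" "list_descents xs = A"
    using list_descents_surj[OF assms] by blast
  show ?thesis
    by (rule ex1I[of _ "Composition xs"])
      (use xs in \<open>auto simp: csize_def descents_def parts_Composition intro!: composition_eqI\<close>)
qed

lemma length_list_descents:
  assumes "0 \<notin> set xs" "xs \<noteq> []"
  shows "length xs = Suc (card (list_descents xs)) \<and> finite (list_descents xs)"
  using assms
proof (induction xs)
  case (Cons x xs)
  show ?case
  proof (cases "xs = []")
    case False
    have IH: "length xs = Suc (card (list_descents xs))" "finite (list_descents xs)"
      using Cons False by auto
    have "x \<notin> (+) x ` list_descents xs"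
      using list_descents_bounds[of xs 0] Cons.prems by auto
    then show ?thesis
      using IH False by (simp add: list_descents_Cons card_image)
  qed simp
qed simp

lemma clength_descents: "\<alpha> \<noteq> 0 \<Longrightarrow> clength \<alpha> = Suc (card (descents \<alpha>))"
  using length_list_descents[OF parts_nonzero, of \<alpha>]
  by (simp add: clength_def descents_def flip: parts_inject)

lemma finite_csize [simp]: "finite {\<alpha>. csize \<alpha> = n}"
proof (rule inj_on_finite)
  show "inj_on descents {\<alpha>. csize \<alpha> = n}"
    by (auto intro!: inj_onI composition_eqI)
  show "descents ` {\<alpha>. csize \<alpha> = n} \<subseteq> Pow {1..<n}"
    using descents_subset by auto
qed simp

text \<open>Refinement order: \<open>\<alpha> \<le> \<beta>\<close> means that \<open>\<alpha>\<close> is finer than \<open>\<beta>\<close>;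
  compositions of different numbers are incomparable.\<close>

instantiation composition :: order
begin

definition "\<alpha> \<le> \<beta> \<longleftrightarrow> csize \<alpha> = csize \<beta> \<and> descents \<beta> \<subseteq> descents \<alpha>"

definition "\<alpha> < \<beta> \<longleftrightarrow> \<alpha> \<le> \<beta> \<and> \<not> \<beta> \<le> (\<alpha> :: composition)"

instance
  by standard (auto simp: less_eq_composition_def less_composition_def intro: composition_eqI)

end

lemma finite_coarser [simp]: "finite {\<beta>. \<alpha> \<le> (\<beta> :: composition)}"
  by (rule finite_subset[OF _ finite_csize[of "csize \<alpha>"]]) (auto simp: less_eq_composition_def)

definition complement :: "composition \<Rightarrow> composition" where
  "complement \<alpha> = (THE \<gamma>. csize \<gamma> = csize \<alpha> \<and> descents \<gamma> = {1..<csize \<alpha>} - descents \<alpha>)"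

lemma csize_complement [simp]: "csize (complement \<alpha>) = csize \<alpha>"
  and descents_complement: "descents (complement \<alpha>) = {1..<csize \<alpha>} - descents \<alpha>"
  using theI'[OF ex1_composition[of "{1..<csize \<alpha>} - descents \<alpha>" "csize \<alpha>"]]
  by (auto simp: complement_def)

definition common_descents_sum :: "composition \<Rightarrow> composition \<Rightarrow> nat" where
  "common_descents_sum \<alpha> \<beta> = \<Sum>(descents \<alpha> \<inter> descents \<beta>)"


section \<open>The free associative algebra over \<open>\<rat>(q)\<close>\<close>

type_synonym ratfun = "rat poly fract"

text \<open>\<open>NC\<Lambda>\<close> is the monoid algebra of compositions under concatenation, the basis element
  \<open>single \<alpha> 1\<close> being the monomial \<open>h\<^sub>\<alpha>\<close>.  Likewise \<open>NC\<Lambda> \<otimes> NC\<Lambda>\<close> is the monoid algebra of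
  pairs of compositions, so its product is componentwise.\<close>

type_synonym ncl = "composition \<Rightarrow>\<^sub>0 ratfun"
type_synonym ncl2 = "(composition \<times> composition) \<Rightarrow>\<^sub>0 ratfun"

definition qq :: ratfun where
  "qq = Fract [:0, 1:] 1"

definition scale :: "ratfun \<Rightarrow> ('a \<Rightarrow>\<^sub>0 ratfun) \<Rightarrow> ('a \<Rightarrow>\<^sub>0 ratfun)" where
  "scale c x = Poly_Mapping.map ((*) c) x"

abbreviation lin :: "(('a \<Rightarrow>\<^sub>0 ratfun) \<Rightarrow> ('b \<Rightarrow>\<^sub>0 ratfun)) \<Rightarrow> bool" where
  "lin \<equiv> Vector_Spaces.linear scale scale"

definition lin_ext :: "('a \<Rightarrow> ('b \<Rightarrow>\<^sub>0 ratfun)) \<Rightarrow> ('a \<Rightarrow>\<^sub>0 ratfun) \<Rightarrow> ('b \<Rightarrow>\<^sub>0 ratfun)" where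
  "lin_ext f x = (\<Sum>a\<in>Poly_Mapping.keys x. scale (Poly_Mapping.lookup x a) (f a))"

definition hh :: "composition \<Rightarrow> ncl" where
  "hh \<alpha> = Poly_Mapping.single \<alpha> 1"

text \<open>The part \<open>(k)\<close>, with the convention that \<open>(0)\<close> is empty, so that \<open>hgen 0 = 1\<close>.\<close>

definition part_or_empty :: "nat \<Rightarrow> composition" where
  "part_or_empty k = (if k = 0 then 0 else one_part k)"

definition hgen :: "nat \<Rightarrow> ncl" where
  "hgen k = hh (part_or_empty k)"

definition ribbon :: "composition \<Rightarrow> ncl" where
  "ribbon \<alpha> = (\<Sum>\<beta> | \<alpha> \<le> \<beta>. scale ((- 1) ^ (clength \<alpha> - clength \<beta>)) (hh \<beta>))"

definition homogeneous :: "nat \<Rightarrow> ncl \<Rightarrow> bool" where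
  "homogeneous d f \<longleftrightarrow> (\<forall>\<alpha>\<in>Poly_Mapping.keys f. csize \<alpha> = d)"

lemma lookup_scale [simp]: "Poly_Mapping.lookup (scale c x) a = c * Poly_Mapping.lookup x a"
  by (simp add: scale_def Poly_Mapping.map.rep_eq when_def)

lemma vector_space_scale: "vector_space (scale :: ratfun \<Rightarrow> ('a \<Rightarrow>\<^sub>0 ratfun) \<Rightarrow> _)"
  by standard (auto intro!: poly_mapping_eqI simp: lookup_add algebra_simps)

global_interpretation scale: vector_space "scale :: ratfun \<Rightarrow> ('a \<Rightarrow>\<^sub>0 ratfun) \<Rightarrow> _"
  by (rule vector_space_scale)

lemma scale_single: "scale c (Poly_Mapping.single a d) = Poly_Mapping.single a (c * d)"
  by (auto intro!: poly_mapping_eqI simp: lookup_single when_def)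

lemma sum_single_keys: "(\<Sum>a\<in>Poly_Mapping.keys x. Poly_Mapping.single a (Poly_Mapping.lookup x a)) = x"
  by (rule poly_mapping_eqI)
    (auto simp: lookup_sum lookup_single when_def in_keys_iff sum.delta)

lemma scale_mult_left: "scale c x * y = scale c (x * y)"
  and scale_mult_right: "x * scale c y = scale c (x * y)"
  for x y :: "'a::monoid_add \<Rightarrow>\<^sub>0 ratfun"
proof -
  have e: "scale c z = Poly_Mapping.single 0 c * z" for z :: "'a \<Rightarrow>\<^sub>0 ratfun"
    by (simp add: scale_def mult_map_scale_conv_mult)
  show "scale c x * y = scale c (x * y)"
    by (simp add: e mult.assoc)
  have comm: "x * Poly_Mapping.single 0 c = Poly_Mapping.single 0 c * x"
  proof -
    let ?s = "\<Sum>a\<in>Poly_Mapping.keys x. Poly_Mapping.single a (Poly_Mapping.lookup x a)"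
    have "?s * Poly_Mapping.single 0 c = Poly_Mapping.single 0 c * ?s"
      by (simp add: sum_distrib_left sum_distrib_right mult_single mult.commute)
    then show ?thesis by (simp add: sum_single_keys)
  qed
  show "x * scale c y = scale c (x * y)"
    by (simp add: e comm flip: mult.assoc)
qed

lemma lin_ext_superset:
  assumes "finite A" "Poly_Mapping.keys x \<subseteq> A"
  shows "lin_ext f x = (\<Sum>a\<in>A. scale (Poly_Mapping.lookup x a) (f a))"
  unfolding lin_ext_def using assms
  by (intro sum.mono_neutral_left) (auto simp: in_keys_iff)

lemma linI:
  assumes "\<And>x y. f (x + y) = f x + f y" "\<And>c x. f (scale c x) = scale c (f x)"
  shows "lin f"
  using assms
  by (simp add: Vector_Spaces.linear_def module_hom_def module_hom_axioms_def
      module_iff_vector_space vector_space_scale)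

lemma lin_add: "lin f \<Longrightarrow> f (x + y) = f x + f y"
  and lin_scale: "lin f \<Longrightarrow> f (scale c x) = scale c (f x)"
  by (simp_all add: Vector_Spaces.linear_def module_hom_def module_hom_axioms_def)

lemma lin_zero: "lin f \<Longrightarrow> f 0 = 0"
  using lin_scale[of f 0 0] by simp

lemma lin_sum: "lin f \<Longrightarrow> f (sum g A) = (\<Sum>a\<in>A. f (g a))"
  by (induction A rule: infinite_finite_induct) (auto simp: lin_add lin_zero)

lemma lin_diff: "lin f \<Longrightarrow> lin g \<Longrightarrow> lin (\<lambda>x. f x - g x)"
  by (intro linI) (auto simp: lin_add lin_scale scale.scale_right_diff_distrib)

lemma lin_minus: "lin f \<Longrightarrow> f (x - y) = f x - f y"
  using lin_add[of f "x - y" y] by simp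

lemma lin_comp: "lin f \<Longrightarrow> lin g \<Longrightarrow> lin (\<lambda>x. f (g x))"
  by (intro linI) (auto simp: lin_add lin_scale)

lemma lin_id: "lin (\<lambda>x. x)" "lin id"
  by (auto intro: linI)

lemma lin_lin_ext [simp, intro]: "lin (lin_ext f)"
proof (rule linI)
  fix x y :: "'a \<Rightarrow>\<^sub>0 ratfun" and c
  let ?A = "Poly_Mapping.keys x \<union> Poly_Mapping.keys y"
  have "Poly_Mapping.keys (x + y) \<subseteq> ?A" by (rule keys_add)
  then show "lin_ext f (x + y) = lin_ext f x + lin_ext f y"
    by (simp add: lin_ext_superset[of ?A] lookup_add scale.scale_left_distrib sum.distrib)
  have "Poly_Mapping.keys (scale c x) \<subseteq> Poly_Mapping.keys x"
    by (auto simp: in_keys_iff)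
  then show "lin_ext f (scale c x) = scale c (lin_ext f x)"
    by (simp add: lin_ext_superset[of "Poly_Mapping.keys x"] scale.scale_sum_right)
qed

lemma lin_ext_single [simp]: "lin_ext f (Poly_Mapping.single a c) = scale c (f a)"
  by (subst lin_ext_superset[of "{a}"]) auto

lemma lin_ext_hh [simp]: "lin_ext f (hh \<alpha>) = f \<alpha>"
  by (simp add: hh_def)

lemma lin_eqI:
  assumes "lin f" "lin g" "\<And>a. f (Poly_Mapping.single a 1) = g (Poly_Mapping.single a 1)"
  shows "f x = g x"
proof -
  have "f x = (\<Sum>a\<in>Poly_Mapping.keys x. scale (Poly_Mapping.lookup x a) (f (Poly_Mapping.single a 1)))"
    if "lin f" for f :: "('a \<Rightarrow>\<^sub>0 ratfun) \<Rightarrow> ('b \<Rightarrow>\<^sub>0 ratfun)"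
  proof -
    have "f x = f (\<Sum>a\<in>Poly_Mapping.keys x. scale (Poly_Mapping.lookup x a) (Poly_Mapping.single a 1))"
      by (simp add: scale_single sum_single_keys)
    then show ?thesis using that by (simp add: lin_sum lin_scale)
  qed
  from this[OF assms(1)] this[OF assms(2)] show ?thesis
    by (simp add: assms(3))
qed

lemma lin_eqI_hh: "lin f \<Longrightarrow> lin g \<Longrightarrow> (\<And>\<alpha>. f (hh \<alpha>) = g (hh \<alpha>)) \<Longrightarrow> f x = g x"
  using lin_eqI[of f g x] by (simp add: hh_def)

lemma hh_zero: "hh 0 = 1"
  by (simp add: hh_def)

lemma hh_plus: "hh (\<alpha> + \<beta>) = hh \<alpha> * hh \<beta>"
  by (simp add: hh_def mult_single)

lemma hgen_0 [simp]: "hgen 0 = 1"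
  by (simp add: hgen_def part_or_empty_def hh_zero)

lemma csize_part_or_empty [simp]: "csize (part_or_empty k) = k"
  by (simp add: part_or_empty_def csize_one_part)

lemma part_or_empty_eq_0_iff [simp]: "part_or_empty k = 0 \<longleftrightarrow> k = 0"
  using csize_eq_0_iff[of "part_or_empty k"] by simp

lemma parts_Cons_obtain:
  assumes "\<alpha> \<noteq> 0"
  obtains k \<beta> where "k > 0" "\<alpha> = part_or_empty k + \<beta>" "parts \<alpha> = k # parts \<beta>"
proof -
  obtain k xs where xs: "parts \<alpha> = k # xs"
    using assms by (cases "parts \<alpha>") (auto simp flip: parts_inject)
  with parts_nonzero[of \<alpha>] have k: "k > 0" "0 \<notin> set xs" by auto
  show ?thesis
    by (rule that[of k "Composition xs"])
      (use xs k in \<open>auto simp: part_or_empty_def parts_one_part parts_Composition simp flip: parts_inject\<close>)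
qed

lemma composition_induct [case_names zero part]:
  assumes "P 0" "\<And>k \<beta>. k > 0 \<Longrightarrow> parts (part_or_empty k + \<beta>) = k # parts \<beta> \<Longrightarrow> P \<beta> \<Longrightarrow> P (part_or_empty k + \<beta>)"
  shows "P \<alpha>"
proof (induction "csize \<alpha>" arbitrary: \<alpha> rule: less_induct)
  case less
  show ?case
  proof (cases "\<alpha> = 0")
    case False
    then obtain k \<beta> where "k > 0" "\<alpha> = part_or_empty k + \<beta>" "parts \<alpha> = k # parts \<beta>"
      by (rule parts_Cons_obtain)
    then show ?thesis using less assms(2)[of k \<beta>] by simp
  qed (use assms in simp)
qed

lemma hh_eq_prod_hgen: "hh \<alpha> = prod_list (map hgen (parts \<alpha>))"
proof (induction \<alpha> rule: composition_induct)
  case (part k \<beta>)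
  then show ?case by (simp add: hgen_def hh_plus del: parts_plus)
qed (simp add: hh_zero)

lemma sum_interval_sign:
  assumes "\<beta> \<le> (\<delta> :: composition)"
  shows "(\<Sum>\<gamma> | \<beta> \<le> \<gamma> \<and> \<gamma> \<le> \<delta>. (- 1) ^ (clength \<gamma> - clength \<delta>)) = (if \<beta> = \<delta> then 1 else 0 :: ratfun)"
proof (cases "\<beta> = \<delta>")
  case True
  then have "{\<gamma>. \<beta> \<le> \<gamma> \<and> \<gamma> \<le> \<delta>} = {\<beta>}" by auto
  then show ?thesis using True by simp
next
  case False
  define I where "I = {X. X \<subseteq> descents \<beta> \<and> descents \<delta> \<subseteq> X}"
  have n0: "csize \<beta> \<noteq> 0"
    using assms False composition_eqI[of \<beta> \<delta>] by (auto simp: less_eq_composition_def)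
  have bij: "bij_betw descents {\<gamma>. \<beta> \<le> \<gamma> \<and> \<gamma> \<le> \<delta>} I"
  proof (rule bij_betw_imageI)
    show "inj_on descents {\<gamma>. \<beta> \<le> \<gamma> \<and> \<gamma> \<le> \<delta>}"
      by (auto intro!: inj_onI composition_eqI simp: less_eq_composition_def)
    show "descents ` {\<gamma>. \<beta> \<le> \<gamma> \<and> \<gamma> \<le> \<delta>} = I"
    proof (intro equalityI subsetI)
      fix X assume X: "X \<in> I"
      then have "X \<subseteq> {1..<csize \<beta>}"
        using descents_subset[of \<beta>] by (auto simp: I_def)
      then obtain \<gamma> where "csize \<gamma> = csize \<beta>" "descents \<gamma> = X"
        using ex1_composition by blast
      then show "X \<in> descents ` {\<gamma>. \<beta> \<le> \<gamma> \<and> \<gamma> \<le> \<delta>}"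
        using X assms by (auto simp: I_def less_eq_composition_def intro!: image_eqI[of _ _ \<gamma>])
    qed (auto simp: I_def less_eq_composition_def)
  qed
  have "descents \<delta> \<noteq> descents \<beta>" "descents \<delta> \<subseteq> descents \<beta>"
    using False assms composition_eqI[of \<beta> \<delta>] by (auto simp: less_eq_composition_def)
  then have "card {T. T \<in> I \<and> even (card T)} = card {T. T \<in> I \<and> odd (card T)}"
    using card_subsupersets_even_odd[of "descents \<beta>" "descents \<delta>"]
    by (simp add: I_def conj_assoc psubset_eq)
  then have z: "(\<Sum>X\<in>I. (- 1) ^ card X) = (0 :: ratfun)"
    by (intro sum_alternating_cancels) (auto simp: I_def)
  have "(\<Sum>\<gamma> | \<beta> \<le> \<gamma> \<and> \<gamma> \<le> \<delta>. (- 1) ^ (clength \<gamma> - clength \<delta>) :: ratfun)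
      = (\<Sum>\<gamma> | \<beta> \<le> \<gamma> \<and> \<gamma> \<le> \<delta>. (- 1) ^ card (descents \<delta>) * (- 1) ^ card (descents \<gamma>))"
  proof (rule sum.cong)
    fix \<gamma> assume "\<gamma> \<in> {\<gamma>. \<beta> \<le> \<gamma> \<and> \<gamma> \<le> \<delta>}"
    then have g: "csize \<gamma> = csize \<beta>" "csize \<delta> = csize \<beta>" "descents \<delta> \<subseteq> descents \<gamma>"
      by (auto simp: less_eq_composition_def)
    with n0 have "\<gamma> \<noteq> 0" "\<delta> \<noteq> 0" using csize_zero by metis+
    then have "clength \<gamma> - clength \<delta> = card (descents \<gamma>) - card (descents \<delta>)"
      by (simp add: clength_descents)
    moreover have "card (descents \<delta>) \<le> card (descents \<gamma>)"
      using g by (simp add: card_mono)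
    ultimately show "(- 1) ^ (clength \<gamma> - clength \<delta>)
        = ((- 1) ^ card (descents \<delta>) * (- 1) ^ card (descents \<gamma>) :: ratfun)"
      by (auto simp: minus_one_power_iff)
  qed simp
  also have "\<dots> = (- 1) ^ card (descents \<delta>) * (\<Sum>X\<in>I. (- 1) ^ card X)"
    using sum.reindex_bij_betw[OF bij, of "\<lambda>X. (- 1) ^ card X :: ratfun"]
    by (simp flip: sum_distrib_left)
  finally show ?thesis using z False by simp
qed

lemma sum_ribbon: "(\<Sum>\<gamma> | \<beta> \<le> \<gamma>. ribbon \<gamma>) = hh \<beta>"
proof -
  let ?f = "\<lambda>\<gamma> \<delta>. scale ((- 1) ^ (clength \<gamma> - clength \<delta>)) (hh \<delta>)"
  have "(\<Sum>\<gamma> | \<beta> \<le> \<gamma>. ribbon \<gamma>) = (\<Sum>\<gamma> | \<beta> \<le> \<gamma>. \<Sum>\<delta> | \<delta> \<in> {\<delta>. \<beta> \<le> \<delta>} \<and> \<gamma> \<le> \<delta>. ?f \<gamma> \<delta>)"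
    unfolding ribbon_def by (intro sum.cong) auto
  also have "\<dots> = (\<Sum>\<delta> | \<beta> \<le> \<delta>. \<Sum>\<gamma> | \<gamma> \<in> {\<gamma>. \<beta> \<le> \<gamma>} \<and> \<gamma> \<le> \<delta>. ?f \<gamma> \<delta>)"
    by (rule sum.swap_restrict) auto
  also have "\<dots> = (\<Sum>\<delta> | \<beta> \<le> \<delta>. scale (\<Sum>\<gamma> | \<beta> \<le> \<gamma> \<and> \<gamma> \<le> \<delta>. (- 1) ^ (clength \<gamma> - clength \<delta>)) (hh \<delta>))"
    by (simp add: scale.scale_sum_left)
  also have "\<dots> = (\<Sum>\<delta> | \<beta> \<le> \<delta>. if \<delta> = \<beta> then hh \<beta> else 0)"
    by (intro sum.cong) (auto simp: sum_interval_sign)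
  finally show ?thesis by (simp add: sum.delta')
qed

lemma lin_eqI_ribbon:
  assumes "lin f" "lin g" "\<And>\<beta>. f (ribbon \<beta>) = g (ribbon \<beta>)"
  shows "f x = g x"
  using assms(1,2)
proof (rule lin_eqI_hh)
  fix \<alpha>
  show "f (hh \<alpha>) = g (hh \<alpha>)"
    using assms by (simp add: lin_sum flip: sum_ribbon)
qed

definition append_op :: "composition \<Rightarrow> ncl \<Rightarrow> ncl" where
  "append_op \<alpha> = (THE A. lin A \<and> (\<forall>\<beta>. A (ribbon \<beta>) = ribbon (\<beta> + \<alpha>)))"

lemma ex1_append_op: "\<exists>!A. lin A \<and> (\<forall>\<beta>. A (ribbon \<beta>) = ribbon (\<beta> + \<alpha>))"
proof (rule ex_ex1I)
  define A where "A = lin_ext (\<lambda>\<beta>. \<Sum>\<gamma> | \<beta> \<le> \<gamma>. ribbon (\<gamma> + \<alpha>))"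
  have A: "lin A" by (simp add: A_def)
  have "A (ribbon \<beta>) = ribbon (\<beta> + \<alpha>)" for \<beta>
  proof (induction "card (descents \<beta>)" arbitrary: \<beta> rule: less_induct)
    case less
    have U: "{\<gamma>. \<beta> \<le> \<gamma>} = insert \<beta> {\<gamma>. \<beta> < \<gamma>}" by auto
    have fin: "finite {\<gamma>. \<beta> < \<gamma>}" using finite_coarser[of \<beta>] by (simp add: U)
    have "A (hh \<beta>) = (\<Sum>\<gamma> | \<beta> \<le> \<gamma>. A (ribbon \<gamma>))"
      by (simp add: lin_sum[OF A] flip: sum_ribbon)
    also have "\<dots> = A (ribbon \<beta>) + (\<Sum>\<gamma> | \<beta> < \<gamma>. A (ribbon \<gamma>))"
      by (simp add: U fin)
    also have "(\<Sum>\<gamma> | \<beta> < \<gamma>. A (ribbon \<gamma>)) = (\<Sum>\<gamma> | \<beta> < \<gamma>. ribbon (\<gamma> + \<alpha>))"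
    proof (intro sum.cong)
      fix \<gamma> assume "\<gamma> \<in> {\<gamma>. \<beta> < \<gamma>}"
      then have "descents \<gamma> \<subset> descents \<beta>"
        by (auto simp: less_composition_def less_eq_composition_def)
      then show "A (ribbon \<gamma>) = ribbon (\<gamma> + \<alpha>)"
        by (intro less) (simp add: psubset_card_mono)
    qed simp
    finally have "A (hh \<beta>) = A (ribbon \<beta>) + (\<Sum>\<gamma> | \<beta> < \<gamma>. ribbon (\<gamma> + \<alpha>))" .
    moreover have "A (hh \<beta>) = ribbon (\<beta> + \<alpha>) + (\<Sum>\<gamma> | \<beta> < \<gamma>. ribbon (\<gamma> + \<alpha>))"
      by (simp add: A_def U fin)
    ultimately show ?case by simp
  qed
  with A show "\<exists>A. lin A \<and> (\<forall>\<beta>. A (ribbon \<beta>) = ribbon (\<beta> + \<alpha>))" by blast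
next
  fix A B assume AB: "lin A \<and> (\<forall>\<beta>. A (ribbon \<beta>) = ribbon (\<beta> + \<alpha>))"
    "lin B \<and> (\<forall>\<beta>. B (ribbon \<beta>) = ribbon (\<beta> + \<alpha>))"
  show "A = B"
  proof
    fix x
    show "A x = B x" by (rule lin_eqI_ribbon) (use AB in auto)
  qed
qed

lemma lin_append_op: "lin (append_op \<alpha>)"
  and append_op_ribbon: "append_op \<alpha> (ribbon \<beta>) = ribbon (\<beta> + \<alpha>)"
  using theI'[OF ex1_append_op[of \<alpha>]] by (auto simp: append_op_def)


section \<open>Hopf algebra structure\<close>

definition tensor :: "ncl \<Rightarrow> ncl \<Rightarrow> ncl2" where
  "tensor x y = lin_ext (\<lambda>\<alpha>. lin_ext (\<lambda>\<beta>. Poly_Mapping.single (\<alpha>, \<beta>) 1) y) x"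

definition tensor_map :: "(ncl \<Rightarrow> ncl) \<Rightarrow> (ncl \<Rightarrow> ncl) \<Rightarrow> ncl2 \<Rightarrow> ncl2" where
  "tensor_map F G = lin_ext (\<lambda>(\<alpha>, \<beta>). tensor (F (hh \<alpha>)) (G (hh \<beta>)))"

definition mu :: "ncl2 \<Rightarrow> ncl" where
  "mu = lin_ext (\<lambda>(\<alpha>, \<beta>). hh \<alpha> * hh \<beta>)"

definition Delta_gen :: "nat \<Rightarrow> ncl2" where
  "Delta_gen k = (\<Sum>i\<le>k. tensor (hgen i) (hgen (k - i)))"

definition Delta :: "ncl \<Rightarrow> ncl2" where
  "Delta = lin_ext (\<lambda>\<alpha>. prod_list (map Delta_gen (parts \<alpha>)))"

definition unit :: "ratfun \<Rightarrow> ncl" where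
  "unit c = scale c 1"

definition counit :: "ncl \<Rightarrow> ratfun" where
  "counit x = Poly_Mapping.lookup x 0"

definition is_antipode :: "(ncl \<Rightarrow> ncl) \<Rightarrow> bool" where
  "is_antipode S \<longleftrightarrow> lin S \<and>
    (\<forall>x. mu (tensor_map S id (Delta x)) = unit (counit x)) \<and>
    (\<forall>x. mu (tensor_map id S (Delta x)) = unit (counit x))"

definition antipode :: "ncl \<Rightarrow> ncl" where
  "antipode = (THE S. is_antipode S)"

lemma tensor_hh: "tensor (hh \<alpha>) (hh \<beta>) = Poly_Mapping.single (\<alpha>, \<beta>) 1"
  by (simp add: tensor_def)

lemma lin_tensor_right: "lin (tensor x)"
proof (rule linI)
  fix y z :: ncl and c
  show "tensor x (y + z) = tensor x y + tensor x z"
    by (simp add: tensor_def lin_ext_def[of _ x] lin_add[OF lin_lin_ext]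
        scale.scale_right_distrib sum.distrib)
  show "tensor x (scale c y) = scale c (tensor x y)"
    by (simp add: tensor_def lin_ext_def[of _ x] lin_scale[OF lin_lin_ext]
        scale.scale_sum_right mult.commute)
qed

lemma lin_tensor_left: "lin (\<lambda>x. tensor x y)"
  unfolding tensor_def by (rule lin_lin_ext)

lemma lin_mult_left: "lin (\<lambda>y. x * y)"
  and lin_mult_right: "lin (\<lambda>x. x * y)"
  for x y :: "'a::monoid_add \<Rightarrow>\<^sub>0 ratfun"
  by (auto intro!: linI simp: algebra_simps scale_mult_left scale_mult_right)

lemma lin_mu: "lin mu" and lin_Delta: "lin Delta" and lin_tensor_map: "lin (tensor_map F G)"
  by (simp_all add: mu_def Delta_def tensor_map_def)

lemma mu_single: "mu (Poly_Mapping.single (\<alpha>, \<beta>) 1) = hh \<alpha> * hh \<beta>"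
  by (simp add: mu_def)

lemma tensor_map_single:
  "tensor_map F G (Poly_Mapping.single (\<alpha>, \<beta>) 1) = tensor (F (hh \<alpha>)) (G (hh \<beta>))"
  by (simp add: tensor_map_def)

lemma mu_tensor: "mu (tensor x y) = x * y"
proof (rule lin_eqI_hh[of "\<lambda>x. mu (tensor x y)" "\<lambda>x. x * y"])
  fix \<alpha>
  show "mu (tensor (hh \<alpha>) y) = hh \<alpha> * y"
    by (rule lin_eqI_hh[of "\<lambda>y. mu (tensor (hh \<alpha>) y)" "\<lambda>y. hh \<alpha> * y"])
      (auto intro: lin_comp[OF lin_mu] lin_tensor_right lin_mult_left simp: tensor_hh mu_single)
qed (auto intro: lin_comp[OF lin_mu] lin_tensor_left lin_mult_right)

lemma tensor_map_tensor:
  assumes "lin F" "lin G"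
  shows "tensor_map F G (tensor x y) = tensor (F x) (G y)"
proof (rule lin_eqI_hh[of "\<lambda>x. tensor_map F G (tensor x y)" "\<lambda>x. tensor (F x) (G y)"])
  fix \<alpha>
  show "tensor_map F G (tensor (hh \<alpha>) y) = tensor (F (hh \<alpha>)) (G y)"
    by (rule lin_eqI_hh[of "\<lambda>y. tensor_map F G (tensor (hh \<alpha>) y)" "\<lambda>y. tensor (F (hh \<alpha>)) (G y)"])
      (auto intro: lin_comp[OF lin_tensor_map] lin_comp[OF lin_tensor_right] assms lin_tensor_right
        simp: tensor_hh tensor_map_single)
qed (auto intro: lin_comp[OF lin_tensor_map] lin_comp[OF lin_tensor_left] assms lin_tensor_left)

lemma Delta_one: "Delta 1 = 1"
  by (simp add: Delta_def flip: hh_zero)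

lemma Delta_hgen: "k > 0 \<Longrightarrow> Delta (hgen k) = Delta_gen k"
  by (simp add: Delta_def hgen_def part_or_empty_def parts_one_part)

lemma Delta_mult: "Delta (x * y) = Delta x * Delta y"
proof (rule lin_eqI_hh[of "\<lambda>x. Delta (x * y)" "\<lambda>x. Delta x * Delta y"])
  fix \<alpha>
  show "Delta (hh \<alpha> * y) = Delta (hh \<alpha>) * Delta y"
  proof (rule lin_eqI_hh[of "\<lambda>y. Delta (hh \<alpha> * y)" "\<lambda>y. Delta (hh \<alpha>) * Delta y"])
    fix \<beta>
    show "Delta (hh \<alpha> * hh \<beta>) = Delta (hh \<alpha>) * Delta (hh \<beta>)"
      by (simp add: Delta_def flip: hh_plus)
  qed (auto intro: lin_comp[OF lin_Delta] lin_comp[OF lin_mult_left] lin_mult_left lin_Delta)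
qed (auto intro: lin_comp[OF lin_Delta] lin_comp[OF lin_mult_right] lin_mult_right lin_Delta)

definition conv :: "(ncl \<Rightarrow> ncl) \<Rightarrow> (ncl \<Rightarrow> ncl) \<Rightarrow> ncl2 \<Rightarrow> ncl" where
  "conv F G = lin_ext (\<lambda>(\<alpha>, \<beta>). F (hh \<alpha>) * G (hh \<beta>))"

lemma mu_tensor_map: "mu (tensor_map F G z) = conv F G z"
  by (rule lin_eqI[of "\<lambda>z. mu (tensor_map F G z)"])
    (auto intro: lin_comp lin_mu lin_tensor_map simp: conv_def tensor_map_def mu_tensor)

lemma lin_conv: "lin (conv F G)"
  by (simp add: conv_def)

lemma conv_single: "conv F G (Poly_Mapping.single (\<alpha>, \<beta>) 1) = F (hh \<alpha>) * G (hh \<beta>)"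
  by (simp add: conv_def)

lemma counit_hh: "counit (hh \<alpha>) = (if \<alpha> = 0 then 1 else 0)"
  by (simp add: counit_def hh_def lookup_single when_def)

lemma lin_unit_counit: "lin (\<lambda>x. unit (counit x))"
  by (rule linI) (simp_all add: unit_def counit_def lookup_add scale.scale_left_distrib)

lemma Delta_part: "k > 0 \<Longrightarrow> Delta (hh (part_or_empty k + \<beta>)) = Delta_gen k * Delta (hh \<beta>)"
  by (simp add: hh_plus Delta_mult Delta_hgen flip: hgen_def)

lemma Delta_gen_mult_single:
  "Delta_gen k * Poly_Mapping.single (\<alpha>, \<beta>) 1
   = (\<Sum>i\<le>k. Poly_Mapping.single (part_or_empty i + \<alpha>, part_or_empty (k - i) + \<beta>) 1)"
  by (simp add: Delta_gen_def hgen_def tensor_hh sum_distrib_right mult_single)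

lemma antipode_exists: "\<exists>S. is_antipode S"
proof -
  define H where "H = Abs_fps hgen"
  define s where "s = fps_nth (fps_left_inverse H 1)"
  have s0: "s 0 = 1" by (simp add: s_def)
  have "fps_left_inverse H 1 * H = 1" "H * fps_left_inverse H 1 = 1"
    by (rule fps_left_inverse fps_right_inverse'; simp add: H_def)+
  then have "fps_nth (fps_left_inverse H 1 * H) k = 0" "fps_nth (H * fps_left_inverse H 1) k = 0" if "k > 0" for k
    using that by simp_all
  then have left: "(\<Sum>i\<le>k. s i * hgen (k - i)) = 0" and right: "(\<Sum>i\<le>k. hgen i * s (k - i)) = 0"
    if "k > 0" for k
    using that by (simp_all add: fps_mult_nth H_def atLeast0AtMost s_def)
  define S where "S = lin_ext (\<lambda>\<alpha>. prod_list (rev (map s (parts \<alpha>))))"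
  have S: "lin S" by (simp add: S_def)
  have S_one: "S 1 = 1" by (simp add: S_def flip: hh_zero)
  have S_part: "S (hh (part_or_empty k + \<beta>)) = S (hh \<beta>) * s k" for k \<beta>
    by (cases "k = 0") (simp_all add: S_def part_or_empty_def parts_one_part s0)
  have L: "conv S id (Delta_gen k * z) = 0" if "k > 0" for k z
  proof (rule lin_eqI[of "\<lambda>z. conv S id (Delta_gen k * z)" "\<lambda>_. 0"])
    fix a :: "composition \<times> composition"
    obtain \<alpha> \<beta> where a: "a = (\<alpha>, \<beta>)" by fastforce
    have "conv S id (Delta_gen k * Poly_Mapping.single a 1)
        = (\<Sum>i\<le>k. S (hh \<alpha>) * (s i * hgen (k - i)) * hh \<beta>)"
      by (simp add: a Delta_gen_mult_single lin_sum[OF lin_conv] conv_single S_part)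
        (simp add: hh_plus hgen_def mult.assoc)
    also have "\<dots> = 0"
      using left[OF that] by (simp flip: sum_distrib_left sum_distrib_right)
    finally show "conv S id (Delta_gen k * Poly_Mapping.single a 1) = 0" .
  qed (auto intro: lin_comp[OF lin_conv] lin_mult_left linI)
  have R: "conv id S (Delta_gen k * z) = (\<Sum>i\<le>k. hgen i * conv id S z * s (k - i))" for k z
  proof (rule lin_eqI[of "\<lambda>z. conv id S (Delta_gen k * z)"
        "\<lambda>z. \<Sum>i\<le>k. hgen i * conv id S z * s (k - i)"])
    fix a :: "composition \<times> composition"
    obtain \<alpha> \<beta> where a: "a = (\<alpha>, \<beta>)" by fastforce
    show "conv id S (Delta_gen k * Poly_Mapping.single a 1)
        = (\<Sum>i\<le>k. hgen i * conv id S (Poly_Mapping.single a 1) * s (k - i))"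
      by (simp add: a Delta_gen_mult_single lin_sum[OF lin_conv] conv_single S_part)
        (simp add: hh_plus hgen_def mult.assoc)
  next
    show "lin (\<lambda>z. \<Sum>i\<le>k. hgen i * conv id S z * s (k - i))"
      by (rule linI) (simp_all add: lin_add[OF lin_conv] lin_scale[OF lin_conv] algebra_simps
          sum.distrib scale_mult_left scale_mult_right scale.scale_sum_right)
  qed (auto intro: lin_comp[OF lin_conv] lin_mult_left)
  have one: "(1 :: ncl2) = Poly_Mapping.single (0, 0) 1"
    by (simp flip: zero_prod_def)
  have base: "conv F G 1 = F 1 * G 1" for F G
    by (simp add: one conv_single hh_zero)
  have L': "conv S id (Delta (hh \<alpha>)) = unit (counit (hh \<alpha>))" for \<alpha>
  proof (induction \<alpha> rule: composition_induct)
    case zero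
    then show ?case by (simp add: hh_zero Delta_one base S_one unit_def counit_def)
  next
    case (part k \<beta>)
    then have "part_or_empty k + \<beta> \<noteq> 0"
      by (simp flip: csize_eq_0_iff)
    then show ?case
      by (simp only: Delta_part[OF part(1)] L[OF part(1)] counit_hh unit_def if_False scale.scale_zero_left)
  qed
  have R': "conv id S (Delta (hh \<alpha>)) = unit (counit (hh \<alpha>))" for \<alpha>
  proof (induction \<alpha> rule: composition_induct)
    case zero
    then show ?case by (simp add: hh_zero Delta_one base S_one unit_def counit_def)
  next
    case (part k \<beta>)
    have "conv id S (Delta (hh (part_or_empty k + \<beta>)))
        = (\<Sum>i\<le>k. hgen i * unit (counit (hh \<beta>)) * s (k - i))"
      by (simp only: Delta_part[OF part(1)] R part.IH)
    also have "\<dots> = scale (counit (hh \<beta>)) (\<Sum>i\<le>k. hgen i * s (k - i))"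
      by (simp add: unit_def scale_mult_left scale_mult_right scale.scale_sum_right)
    also have "\<dots> = 0"
      by (simp only: right[OF part(1)] scale.scale_zero_right)
    also have "part_or_empty k + \<beta> \<noteq> 0"
      using part by (simp flip: csize_eq_0_iff)
    then have "0 = unit (counit (hh (part_or_empty k + \<beta>)))"
      by (simp add: counit_hh unit_def)
    finally show ?case .
  qed
  have "conv S id (Delta x) = unit (counit x)" "conv id S (Delta x) = unit (counit x)" for x
    using L' R' lin_unit_counit lin_comp[OF lin_conv lin_Delta]
    by (auto intro: lin_eqI_hh[of "\<lambda>x. conv _ _ (Delta x)" "\<lambda>x. unit (counit x)"])
  then show ?thesis
    using S by (auto simp: is_antipode_def mu_tensor_map intro!: exI[of _ S])
qed

lemma keys_mult_cases:
  assumes "c \<in> Poly_Mapping.keys (x * y)"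
  obtains a b where "a \<in> Poly_Mapping.keys x" "b \<in> Poly_Mapping.keys y" "c = a + b"
  using assms keys_mult[of x y] by blast

lemma Delta_gen_split:
  "Delta_gen k = Poly_Mapping.single (part_or_empty k, 0) 1
     + (\<Sum>i<k. Poly_Mapping.single (part_or_empty i, part_or_empty (k - i)) 1)"
  by (simp add: Delta_gen_def hgen_def tensor_hh lessThan_Suc_atMost[symmetric] part_or_empty_def
      add.commute)

lemma keys_sum_single:
  assumes "a \<in> Poly_Mapping.keys (\<Sum>i\<in>I. Poly_Mapping.single (f i) (1 :: ratfun))"
  shows "a \<in> f ` I"
  using assms by (induction I rule: infinite_finite_induct) (use keys_add in \<open>fastforce\<close>)+

text \<open>The coproduct of \<open>h\<^sub>\<alpha>\<close> is \<open>h\<^sub>\<alpha> \<otimes> 1\<close> plus terms with smaller left factor.\<close>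

lemma Delta_hh_split:
  "\<exists>r. Delta (hh \<alpha>) = Poly_Mapping.single (\<alpha>, 0) 1 + r \<and>
    (\<forall>(\<beta>, \<gamma>)\<in>Poly_Mapping.keys r. csize \<beta> + csize \<gamma> = csize \<alpha> \<and> \<gamma> \<noteq> 0)"
proof (induction \<alpha> rule: composition_induct)
  case zero
  then show ?case
    by (intro exI[of _ 0]) (simp add: hh_zero Delta_one flip: zero_prod_def)
next
  case (part k \<beta>)
  obtain r where r: "Delta (hh \<beta>) = Poly_Mapping.single (\<beta>, 0) 1 + r"
    "\<And>\<delta> \<gamma>. (\<delta>, \<gamma>) \<in> Poly_Mapping.keys r \<Longrightarrow> csize \<delta> + csize \<gamma> = csize \<beta> \<and> \<gamma> \<noteq> 0"
    using part by blast
  define t :: ncl2 where "t = (\<Sum>i<k. Poly_Mapping.single (part_or_empty i, part_or_empty (k - i)) 1)"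
  have t: "csize \<delta> + csize \<gamma> = k \<and> \<gamma> \<noteq> 0" if "(\<delta>, \<gamma>) \<in> Poly_Mapping.keys t" for \<delta> \<gamma>
    using keys_sum_single[OF that[unfolded t_def]] by auto
  define u where "u = Poly_Mapping.single (part_or_empty k, 0) 1 * r
      + (t * Poly_Mapping.single (\<beta>, 0) 1 + t * r)"
  have "Delta (hh (part_or_empty k + \<beta>)) = Poly_Mapping.single (part_or_empty k + \<beta>, 0) 1 + u"
    using part(1) by (simp add: Delta_part r Delta_gen_split u_def algebra_simps mult_single
        flip: t_def)
  moreover have "csize \<delta> + csize \<gamma> = csize (part_or_empty k + \<beta>) \<and> \<gamma> \<noteq> 0"
    if "(\<delta>, \<gamma>) \<in> Poly_Mapping.keys u" for \<delta> \<gamma>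
  proof -
    have "(\<delta>, \<gamma>) \<in> Poly_Mapping.keys (Poly_Mapping.single (part_or_empty k, 0) 1 * r)
        \<or> (\<delta>, \<gamma>) \<in> Poly_Mapping.keys (t * Poly_Mapping.single (\<beta>, 0) 1)
        \<or> (\<delta>, \<gamma>) \<in> Poly_Mapping.keys (t * r)"
      using that keys_add[of "Poly_Mapping.single (part_or_empty k, 0) 1 * r"]
        keys_add[of "t * Poly_Mapping.single (\<beta>, 0) 1" "t * r"]
      unfolding u_def by blast
    then show ?thesis
      by (elim disjE keys_mult_cases)
        (auto dest!: t r(2) simp flip: csize_eq_0_iff)
  qed
  ultimately show ?case by blast
qed

lemma left_convolution_zero:
  assumes "lin U" "\<And>x. conv U id (Delta x) = 0"
  shows "U x = 0"
proof (rule lin_eqI_hh[of U "\<lambda>_. 0"])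
  fix \<alpha>
  show "U (hh \<alpha>) = 0"
  proof (induction "csize \<alpha>" arbitrary: \<alpha> rule: less_induct)
    case less
    obtain r where r: "Delta (hh \<alpha>) = Poly_Mapping.single (\<alpha>, 0) 1 + r"
      "\<And>\<beta> \<gamma>. (\<beta>, \<gamma>) \<in> Poly_Mapping.keys r \<Longrightarrow> csize \<beta> + csize \<gamma> = csize \<alpha> \<and> \<gamma> \<noteq> 0"
      using Delta_hh_split by blast
    have "U (hh \<beta>) = 0" if "(\<beta>, \<gamma>) \<in> Poly_Mapping.keys r" for \<beta> \<gamma>
    proof (rule less)
      have "csize \<gamma> \<noteq> 0" "csize \<beta> + csize \<gamma> = csize \<alpha>"
        using r(2)[OF that] by auto
      then show "csize \<beta> < csize \<alpha>" by linarith
    qed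
    then have "conv U id r = 0"
      by (auto simp: conv_def lin_ext_def intro!: sum.neutral)
    then show ?case
      using assms(2)[of "hh \<alpha>"] by (simp add: r lin_add[OF lin_conv] conv_single hh_zero)
  qed
qed (use assms in \<open>auto intro: linI\<close>)

lemma ex1_antipode: "\<exists>!S. is_antipode S"
proof (rule ex_ex1I)
  fix S T assume ST: "is_antipode S" "is_antipode T"
  have *: "conv (\<lambda>x. S x - T x) id z = conv S id z - conv T id z" for z
    by (rule lin_eqI[of _ "\<lambda>z. conv S id z - conv T id z"])
      (auto intro: lin_diff lin_conv simp: conv_def algebra_simps)
  have "S x - T x = 0" for x
    by (rule left_convolution_zero[of "\<lambda>x. S x - T x"])
      (use ST in \<open>auto simp: is_antipode_def mu_tensor_map * intro: lin_diff\<close>)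
  then show "S = T" by (intro ext) simp
qed (rule antipode_exists)

lemma antipode: "is_antipode antipode"
  unfolding antipode_def by (rule theI'[OF ex1_antipode])


section \<open>Operators and their \<open>q\<close>-analogs\<close>

definition bar :: "(ncl \<Rightarrow> ncl) \<Rightarrow> ncl \<Rightarrow> ncl" where
  "bar V = mu \<circ> tensor_map id (V \<circ> antipode) \<circ> Delta"

definition Rq :: "ncl \<Rightarrow> ncl" where
  "Rq = lin_ext (\<lambda>\<alpha>. scale (qq ^ csize \<alpha>) (hh \<alpha>))"

lemma Rq_homogeneous:
  assumes "homogeneous d f"
  shows "Rq f = scale (qq ^ d) f"
proof -
  have "Rq f = (\<Sum>\<alpha>\<in>Poly_Mapping.keys f. scale (qq ^ d) (Poly_Mapping.single \<alpha> (Poly_Mapping.lookup f \<alpha>)))"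
    unfolding Rq_def lin_ext_def using assms
    by (intro sum.cong) (auto simp: homogeneous_def hh_def scale_single mult.commute)
  then show ?thesis
    by (simp add: sum_single_keys flip: scale.scale_sum_right)
qed

definition q_analog :: "(ncl \<Rightarrow> ncl) \<Rightarrow> ncl \<Rightarrow> ncl" where
  "q_analog V = bar (bar V \<circ> bar Rq)"

definition Hq :: "composition \<Rightarrow> ncl" where
  "Hq \<alpha> = (\<Sum>\<beta> | csize \<beta> = csize \<alpha> \<and> \<alpha> \<le> \<beta>.
      scale (qq ^ common_descents_sum \<alpha> (complement \<beta>)) (ribbon \<beta>))"

end

theory Submission
  imports Defs
begin

text \<open>
  Write \<open>S\<close> for the antipode and use Sweedler notation. Since the coproduct is cocommutative,
  \<open>S\<close> is an involution commuting with the coproduct, so \<open>bar\<close> is an involution on linear maps.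
  The product rule \<open>s\<^sub>\<alpha> s\<^sub>\<beta> = s\<^bsub>\<alpha>\<cdot>\<beta>\<^esub> + s\<^bsub>\<alpha>\<odot>\<beta>\<^esub>\<close>, with \<open>\<odot>\<close> merging the adjacent end parts,
  shows that \<open>V = A\<^sub>m\<close> satisfies \<open>V(x y) = x V(y)\<close> whenever \<open>y\<close> has counit zero. Applying such a \<open>V\<close>
  to \<open>f\<^sub>1 S(f\<^sub>2)\<close> and to \<open>f\<^sub>1 R\<^sup>q(S(f\<^sub>2))\<close> collapses its \<open>q\<close>-analog to
  \<open>f \<mapsto> R\<^sup>q(f) V(1) + V(f) - V(R\<^sup>q(f))\<close>, which sends \<open>s\<^sub>\<beta>\<close> to \<open>s\<^bsub>\<beta>\<cdot>m\<^esub> + q\<^bsup>|\<beta>|\<^esup> s\<^bsub>\<beta>\<odot>m\<^esub>\<close>.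
  The same recursion holds for \<open>H\<^sub>\<alpha>\<close>: a coarsening of \<open>\<alpha>\<cdot>m\<close> is \<open>\<beta>\<cdot>m\<close> or \<open>\<beta>\<odot>m\<close> with
  \<open>\<beta> \<ge> \<alpha>\<close>, and only the latter has the additional descent \<open>|\<alpha>|\<close> in its complement.
\<close>

subsection \<open>Near-concatenation of compositions\<close>

lemma list_descents_append:
  assumes "xs \<noteq> []" "ys \<noteq> []"
  shows "list_descents (xs @ ys)
    = insert (sum_list xs) (list_descents xs \<union> (+) (sum_list xs) ` list_descents ys)"
  using assms
proof (induction xs)
  case (Cons x xs)
  show ?case
  proof (cases "xs = []")
    case False
    then show ?thesis
      using Cons by (simp add: list_descents_Cons image_Un image_image add.assoc insert_commute)
  qed (use Cons in \<open>simp add: list_descents_Cons\<close>)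
qed simp

lemma parts_eq_Nil_iff [simp]: "parts \<alpha> = [] \<longleftrightarrow> \<alpha> = 0"
  by (metis parts_inject parts_zero)

lemma descents_plus:
  assumes "\<alpha> \<noteq> 0" "\<beta> \<noteq> 0"
  shows "descents (\<alpha> + \<beta>)
    = insert (csize \<alpha>) (descents \<alpha> \<union> (+) (csize \<alpha>) ` descents \<beta>)"
  using assms by (simp add: descents_def csize_def list_descents_append)

lemma descents_one_part [simp]: "m > 0 \<Longrightarrow> descents (one_part m) = {}"
  by (simp add: descents_def parts_one_part)

lemma one_part_nonzero [simp]: "m > 0 \<Longrightarrow> one_part m \<noteq> 0"
  by (simp add: csize_one_part flip: csize_eq_0_iff)

lemma coarser_one_part: "m > 0 \<Longrightarrow> {\<beta>. one_part m \<le> \<beta>} = {one_part m}"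
  by (auto simp: less_eq_composition_def intro: composition_eqI)

lemma coarser_zero: "{\<beta>. 0 \<le> (\<beta> :: composition)} = {0}"
  by (auto simp: less_eq_composition_def)

lemma coarser_nonzero: "\<alpha> \<le> \<beta> \<Longrightarrow> \<alpha> \<noteq> 0 \<Longrightarrow> \<beta> \<noteq> (0 :: composition)"
  by (auto simp: less_eq_composition_def)

lemma descents_lower: "a \<in> descents \<alpha> \<Longrightarrow> 0 < a"
  and descents_upper: "a \<in> descents \<alpha> \<Longrightarrow> a < csize \<alpha>"
  using descents_subset[of \<alpha>] by auto

text \<open>This is the composition whose middle part is the sum of the last part of \<alpha> and
  the first part of \<beta>. Encoding it by descent sets makes it total, with the empty composition
  neutral, and turns coarsening into set inclusion.\<close>

definition near_concat :: "composition \<Rightarrow> composition \<Rightarrow> composition" where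
  "near_concat \<alpha> \<beta> = (THE \<gamma>. csize \<gamma> = csize \<alpha> + csize \<beta>
      \<and> descents \<gamma> = descents \<alpha> \<union> (+) (csize \<alpha>) ` descents \<beta>)"

lemma csize_near_concat [simp]: "csize (near_concat \<alpha> \<beta>) = csize \<alpha> + csize \<beta>"
  and descents_near_concat:
    "descents (near_concat \<alpha> \<beta>) = descents \<alpha> \<union> (+) (csize \<alpha>) ` descents \<beta>"
proof -
  have "descents \<alpha> \<union> (+) (csize \<alpha>) ` descents \<beta> \<subseteq> {1..<csize \<alpha> + csize \<beta>}"
    using descents_subset[of \<alpha>] descents_subset[of \<beta>] by fastforce
  from theI'[OF ex1_composition[OF this]]
  show "csize (near_concat \<alpha> \<beta>) = csize \<alpha> + csize \<beta>"
    "descents (near_concat \<alpha> \<beta>) = descents \<alpha> \<union> (+) (csize \<alpha>) ` descents \<beta>"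
    by (auto simp: near_concat_def)
qed

lemma csize_notin_near_concat: "csize \<alpha> \<notin> descents (near_concat \<alpha> \<beta>)"
  using descents_upper[of "csize \<alpha>" \<alpha>] descents_lower[of 0 \<beta>]
  by (auto simp: descents_near_concat)

lemma near_concat_nonzero: "\<alpha> \<noteq> 0 \<Longrightarrow> near_concat \<alpha> \<beta> \<noteq> 0"
  by (simp flip: csize_eq_0_iff)

text \<open>Compared with \<alpha> + \<beta>, merging loses exactly the descent
  \<open>csize \<alpha>\<close>.\<close>

lemma clength_near_concat:
  assumes "\<alpha> \<noteq> 0" "\<beta> \<noteq> 0"
  shows "Suc (clength (near_concat \<alpha> \<beta>)) = clength \<alpha> + clength \<beta>"
proof -
  have "\<alpha> + \<beta> \<noteq> 0" using assms by (simp flip: csize_eq_0_iff)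
  then have "clength (\<alpha> + \<beta>) = Suc (card (descents (\<alpha> + \<beta>)))"
    by (rule clength_descents)
  also have "descents (\<alpha> + \<beta>) = insert (csize \<alpha>) (descents (near_concat \<alpha> \<beta>))"
    using assms by (simp add: descents_plus descents_near_concat)
  finally have "clength (\<alpha> + \<beta>) = Suc (clength (near_concat \<alpha> \<beta>))"
    using csize_notin_near_concat[of \<alpha> \<beta>]
    by (simp add: clength_descents[OF near_concat_nonzero[OF assms(1)]])
  then show ?thesis by (simp add: clength_def)
qed

text \<open>A known cut point \<open>csize \<gamma>\<close> separates the descents of \<gamma> below
  it from the shifted descents of \<delta> above it.\<close>

lemma near_concat_inject:
  assumes "near_concat \<gamma> \<delta> = near_concat \<gamma>' \<delta>'" "csize \<gamma> = csize \<gamma>'"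
  shows "\<gamma> = \<gamma>' \<and> \<delta> = \<delta>'"
proof -
  have left: "descents \<gamma> = descents (near_concat \<gamma> \<delta>) \<inter> {..<csize \<gamma>}" for \<gamma> \<delta>
    using descents_upper[of _ \<gamma>] by (auto simp: descents_near_concat)
  have right: "descents \<delta> = {x. csize \<gamma> + x \<in> descents (near_concat \<gamma> \<delta>)}" for \<gamma> \<delta>
    using descents_upper[of _ \<gamma>] by (fastforce simp: descents_near_concat)
  have "csize \<delta> = csize \<delta>'"
    using arg_cong[OF assms(1), of csize] assms(2) by simp
  then show ?thesis
    using assms left[of \<gamma> \<delta>] left[of \<gamma>' \<delta>'] right[of \<delta> \<gamma>] right[of \<delta>' \<gamma>']
    by (auto intro!: composition_eqI)
qed

text \<open>A coarsening of \<open>near_concat \<alpha> \<beta>\<close> cut at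
  \<open>csize \<alpha>\<close> falls apart into a coarsening of \<alpha> and one of
  \<beta>.\<close>

lemma bij_near_concat:
  "bij_betw (\<lambda>(\<gamma>, \<delta>). near_concat \<gamma> \<delta>) ({\<gamma>. \<alpha> \<le> \<gamma>} \<times> {\<delta>. \<beta> \<le> \<delta>})
    {\<epsilon>. near_concat \<alpha> \<beta> \<le> \<epsilon>}"
proof (rule bij_betw_imageI)
  show "inj_on (\<lambda>(\<gamma>, \<delta>). near_concat \<gamma> \<delta>) ({\<gamma>. \<alpha> \<le> \<gamma>} \<times> {\<delta>. \<beta> \<le> \<delta>})"
    by (auto simp: inj_on_def less_eq_composition_def dest!: near_concat_inject)
  have "\<epsilon> \<in> (\<lambda>(\<gamma>, \<delta>). near_concat \<gamma> \<delta>) ` ({\<gamma>. \<alpha> \<le> \<gamma>} \<times> {\<delta>. \<beta> \<le> \<delta>})"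
    if "near_concat \<alpha> \<beta> \<le> \<epsilon>" for \<epsilon>
  proof -
    let ?n = "csize \<alpha>"
    have \<epsilon>: "csize \<epsilon> = ?n + csize \<beta>" "descents \<epsilon> \<subseteq> descents \<alpha> \<union> (+) ?n ` descents \<beta>"
      using that by (simp_all add: less_eq_composition_def descents_near_concat)
    have sub1: "descents \<epsilon> \<inter> {..<?n} \<subseteq> descents \<alpha>"
      using \<epsilon>(2) by auto
    then obtain \<gamma> where \<gamma>: "csize \<gamma> = ?n" "descents \<gamma> = descents \<epsilon> \<inter> {..<?n}"
      using ex1_composition[of "descents \<epsilon> \<inter> {..<?n}" ?n] descents_subset[of \<alpha>] by blast
    have sub2: "{x. ?n + x \<in> descents \<epsilon>} \<subseteq> descents \<beta>"
      using \<epsilon>(2) descents_upper[of _ \<alpha>] by fastforce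
    then obtain \<delta> where \<delta>: "csize \<delta> = csize \<beta>" "descents \<delta> = {x. ?n + x \<in> descents \<epsilon>}"
      using ex1_composition[of "{x. ?n + x \<in> descents \<epsilon>}" "csize \<beta>"] descents_subset[of \<beta>]
      by blast
    have "\<epsilon> = near_concat \<gamma> \<delta>"
    proof (rule composition_eqI)
      show "descents \<epsilon> = descents (near_concat \<gamma> \<delta>)"
        using \<epsilon>(2) descents_upper[of _ \<alpha>] by (auto simp: descents_near_concat \<gamma> \<delta>)
    qed (simp add: \<epsilon> \<gamma> \<delta>)
    moreover have "\<alpha> \<le> \<gamma>" "\<beta> \<le> \<delta>"
      using sub1 sub2 by (simp_all add: less_eq_composition_def \<gamma> \<delta>)
    ultimately show ?thesis by auto
  qed
  moreover have "near_concat \<alpha> \<beta> \<le> near_concat \<gamma> \<delta>" if "\<alpha> \<le> \<gamma>" "\<beta> \<le> \<delta>" for \<gamma> \<delta>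
    using that by (auto simp: less_eq_composition_def descents_near_concat)
  ultimately show "(\<lambda>(\<gamma>, \<delta>). near_concat \<gamma> \<delta>) ` ({\<gamma>. \<alpha> \<le> \<gamma>} \<times> {\<delta>. \<beta> \<le> \<delta>})
      = {\<epsilon>. near_concat \<alpha> \<beta> \<le> \<epsilon>}"
    by auto
qed

lemma sum_coarser_near_concat:
  "(\<Sum>\<epsilon> | near_concat \<alpha> \<beta> \<le> \<epsilon>. F \<epsilon>)
    = (\<Sum>\<gamma> | \<alpha> \<le> \<gamma>. \<Sum>\<delta> | \<beta> \<le> \<delta>. F (near_concat \<gamma> \<delta>))"
  using sum.reindex_bij_betw[OF bij_near_concat, of F \<alpha> \<beta>]
  by (simp add: sum.cartesian_product case_prod_beta)

text \<open>The coarsenings of \<alpha> + \<beta> are split by whether they keep the descent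
  \<open>csize \<alpha>\<close>: those that do are the concatenations, the others are the
  coarsenings of \<open>near_concat \<alpha> \<beta>\<close>.\<close>

lemma sum_coarser_plus:
  fixes F :: "composition \<Rightarrow> 'a::comm_monoid_add"
  assumes "\<alpha> \<noteq> 0" "\<beta> \<noteq> 0"
  shows "(\<Sum>\<epsilon> | \<alpha> + \<beta> \<le> \<epsilon>. F \<epsilon>)
    = (\<Sum>\<gamma> | \<alpha> \<le> \<gamma>. \<Sum>\<delta> | \<beta> \<le> \<delta>. F (\<gamma> + \<delta>) + F (near_concat \<gamma> \<delta>))"
proof -
  let ?n = "csize \<alpha>"
  define A where "A = {\<gamma>. \<alpha> \<le> \<gamma>} \<times> {\<delta>. \<beta> \<le> \<delta>}"
  have A: "csize \<gamma> = ?n" "csize \<delta> = csize \<beta>" "\<gamma> \<noteq> 0" "\<delta> \<noteq> 0" if "(\<gamma>, \<delta>) \<in> A" for \<gamma> \<delta>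
    using that assms coarser_nonzero by (auto simp: A_def less_eq_composition_def)
  have plus: "descents (\<gamma> + \<delta>) = insert ?n (descents (near_concat \<gamma> \<delta>))" if "(\<gamma>, \<delta>) \<in> A" for \<gamma> \<delta>
    using A[OF that] by (simp add: descents_plus descents_near_concat)
  have notin: "?n \<notin> descents (near_concat \<gamma> \<delta>)" if "(\<gamma>, \<delta>) \<in> A" for \<gamma> \<delta>
    using A[OF that] csize_notin_near_concat[of \<gamma> \<delta>] by simp
  have AA: "(\<alpha>, \<beta>) \<in> A" by (simp add: A_def)
  define B where "B = {\<epsilon>. \<alpha> + \<beta> \<le> \<epsilon> \<and> ?n \<in> descents \<epsilon>}"
  have "bij_betw (\<lambda>(\<gamma>, \<delta>). \<gamma> + \<delta>) A B"
  proof (rule bij_betw_imageI)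
    show "inj_on (\<lambda>(\<gamma>, \<delta>). \<gamma> + \<delta>) A"
    proof (rule inj_onI, clarify)
      fix \<gamma> \<delta> \<gamma>' \<delta>' assume *: "(\<gamma>, \<delta>) \<in> A" "(\<gamma>', \<delta>') \<in> A" "\<gamma> + \<delta> = \<gamma>' + \<delta>'"
      have "near_concat \<gamma> \<delta> = near_concat \<gamma>' \<delta>'"
      proof (rule composition_eqI)
        show "descents (near_concat \<gamma> \<delta>) = descents (near_concat \<gamma>' \<delta>')"
          using plus[OF *(1)] plus[OF *(2)] notin[OF *(1)] notin[OF *(2)] *(3)
          by (metis insert_ident)
      qed (use A[OF *(1)] A[OF *(2)] in simp)
      then show "\<gamma> = \<gamma>' \<and> \<delta> = \<delta>'"
        using A[OF *(1)] A[OF *(2)] by (intro near_concat_inject) simp_all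
    qed
    have "\<epsilon> \<in> (\<lambda>(\<gamma>, \<delta>). \<gamma> + \<delta>) ` A" if "\<epsilon> \<in> B" for \<epsilon>
    proof -
      have \<epsilon>: "csize \<epsilon> = ?n + csize \<beta>" "?n \<in> descents \<epsilon>"
        "descents \<epsilon> \<subseteq> insert ?n (descents (near_concat \<alpha> \<beta>))"
        using that plus[OF AA] by (auto simp: B_def less_eq_composition_def)
      \<comment> \<open>Deleting the cut point reduces surjectivity to
        \<open>bij_near_concat\<close>.\<close>
      obtain \<epsilon>' where \<epsilon>': "csize \<epsilon>' = csize \<epsilon>" "descents \<epsilon>' = descents \<epsilon> - {?n}"
        using ex1_composition[of "descents \<epsilon> - {?n}" "csize \<epsilon>"] descents_subset[of \<epsilon>] by blast
      have "near_concat \<alpha> \<beta> \<le> \<epsilon>'"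
        using \<epsilon> by (auto simp: less_eq_composition_def \<epsilon>')
      then obtain \<gamma> \<delta> where gd: "(\<gamma>, \<delta>) \<in> A" "\<epsilon>' = near_concat \<gamma> \<delta>"
        using bij_betw_imp_surj_on[OF bij_near_concat[of \<alpha> \<beta>]] unfolding A_def by fastforce
      have "\<epsilon> = \<gamma> + \<delta>"
      proof (rule composition_eqI)
        show "csize \<epsilon> = csize (\<gamma> + \<delta>)"
          using \<epsilon>'(1) gd(2) by simp
        show "descents \<epsilon> = descents (\<gamma> + \<delta>)"
          using \<epsilon>(2) \<epsilon>'(2) plus[OF gd(1)] by (auto simp flip: gd(2))
      qed
      then show ?thesis using gd(1) by auto
    qed
    moreover have "\<gamma> + \<delta> \<in> B" if "(\<gamma>, \<delta>) \<in> A" for \<gamma> \<delta>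
      using that plus[OF that] plus[OF AA] A[OF that]
      by (auto simp: A_def B_def less_eq_composition_def descents_near_concat)
    ultimately show "(\<lambda>(\<gamma>, \<delta>). \<gamma> + \<delta>) ` A = B"
      by auto
  qed
  from sum.reindex_bij_betw[OF this, of F]
  have "(\<Sum>\<epsilon>\<in>B. F \<epsilon>) = (\<Sum>\<gamma> | \<alpha> \<le> \<gamma>. \<Sum>\<delta> | \<beta> \<le> \<delta>. F (\<gamma> + \<delta>))"
    by (simp add: A_def sum.cartesian_product case_prod_beta)
  moreover have "{\<epsilon>. \<alpha> + \<beta> \<le> \<epsilon>} = B \<union> {\<epsilon>. near_concat \<alpha> \<beta> \<le> \<epsilon>}"
    "B \<inter> {\<epsilon>. near_concat \<alpha> \<beta> \<le> \<epsilon>} = {}"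
    using plus[OF AA] notin[OF AA] by (auto simp: B_def less_eq_composition_def)
  moreover have "finite B"
    by (rule finite_subset[OF _ finite_coarser[of "\<alpha> + \<beta>"]]) (auto simp: B_def)
  ultimately show ?thesis
    by (simp add: sum.union_disjoint sum_coarser_near_concat sum.distrib)
qed

subsection \<open>Products of ribbon Schur functions\<close>

lemma ribbon_zero [simp]: "ribbon 0 = 1"
  by (simp add: ribbon_def coarser_zero hh_zero)

lemma clength_antimono: "\<alpha> \<le> \<beta> \<Longrightarrow> clength \<beta> \<le> clength \<alpha>"
  by (cases "\<alpha> = 0")
    (auto simp: clength_descents coarser_nonzero less_eq_composition_def card_mono)

lemma clength_plus: "clength (\<alpha> + \<beta>) = clength \<alpha> + clength \<beta>"
  by (simp add: clength_def)

text \<open>By \<open>sum_coarser_plus\<close>, the expansion of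
  \<open>ribbon (\<alpha> + \<beta>)\<close> consists of concatenated and merged terms. A merged
  term has one part less, hence the opposite sign, so adding
  \<open>ribbon (near_concat \<alpha> \<beta>)\<close> cancels the merged terms and leaves the
  product.\<close>

lemma ribbon_mult:
  assumes "\<alpha> \<noteq> 0" "\<beta> \<noteq> 0"
  shows "ribbon \<alpha> * ribbon \<beta> = ribbon (\<alpha> + \<beta>) + ribbon (near_concat \<alpha> \<beta>)"
proof -
  let ?s = "\<lambda>\<gamma> \<delta>. (- 1) ^ (clength \<alpha> - clength \<gamma>) * (- 1) ^ (clength \<beta> - clength \<delta>) :: ratfun"
  have "ribbon (\<alpha> + \<beta>) = (\<Sum>\<gamma> | \<alpha> \<le> \<gamma>. \<Sum>\<delta> | \<beta> \<le> \<delta>.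
      scale (?s \<gamma> \<delta>) (hh (\<gamma> + \<delta>)) - scale (?s \<gamma> \<delta>) (hh (near_concat \<gamma> \<delta>)))"
    unfolding ribbon_def sum_coarser_plus[OF assms]
  proof (intro sum.cong refl)
    fix \<gamma> \<delta> assume "\<gamma> \<in> {\<gamma>. \<alpha> \<le> \<gamma>}" "\<delta> \<in> {\<delta>. \<beta> \<le> \<delta>}"
    then have le: "clength \<gamma> \<le> clength \<alpha>" "clength \<delta> \<le> clength \<beta>" and nz: "\<gamma> \<noteq> 0" "\<delta> \<noteq> 0"
      using assms coarser_nonzero by (auto intro: clength_antimono)
    have "clength (\<alpha> + \<beta>) - clength (\<gamma> + \<delta>) = (clength \<alpha> - clength \<gamma>) + (clength \<beta> - clength \<delta>)"
      "clength (\<alpha> + \<beta>) - clength (near_concat \<gamma> \<delta>)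
        = Suc ((clength \<alpha> - clength \<gamma>) + (clength \<beta> - clength \<delta>))"
      using le clength_near_concat[OF nz] by (auto simp: clength_plus)
    then show "scale ((- 1) ^ (clength (\<alpha> + \<beta>) - clength (\<gamma> + \<delta>))) (hh (\<gamma> + \<delta>)) +
        scale ((- 1) ^ (clength (\<alpha> + \<beta>) - clength (near_concat \<gamma> \<delta>))) (hh (near_concat \<gamma> \<delta>))
      = scale (?s \<gamma> \<delta>) (hh (\<gamma> + \<delta>)) - scale (?s \<gamma> \<delta>) (hh (near_concat \<gamma> \<delta>))"
      by (simp add: power_add)
  qed
  moreover have "ribbon (near_concat \<alpha> \<beta>) = (\<Sum>\<gamma> | \<alpha> \<le> \<gamma>. \<Sum>\<delta> | \<beta> \<le> \<delta>.
      scale (?s \<gamma> \<delta>) (hh (near_concat \<gamma> \<delta>)))"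
    unfolding ribbon_def sum_coarser_near_concat
  proof (intro sum.cong refl)
    fix \<gamma> \<delta> assume "\<gamma> \<in> {\<gamma>. \<alpha> \<le> \<gamma>}" "\<delta> \<in> {\<delta>. \<beta> \<le> \<delta>}"
    then have le: "clength \<gamma> \<le> clength \<alpha>" "clength \<delta> \<le> clength \<beta>" and nz: "\<gamma> \<noteq> 0" "\<delta> \<noteq> 0"
      using assms coarser_nonzero by (auto intro: clength_antimono)
    have "clength (near_concat \<alpha> \<beta>) - clength (near_concat \<gamma> \<delta>)
        = (clength \<alpha> - clength \<gamma>) + (clength \<beta> - clength \<delta>)"
      using le clength_near_concat[OF nz] clength_near_concat[OF assms] by auto
    then show "scale ((- 1) ^ (clength (near_concat \<alpha> \<beta>) - clength (near_concat \<gamma> \<delta>)))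
        (hh (near_concat \<gamma> \<delta>)) = scale (?s \<gamma> \<delta>) (hh (near_concat \<gamma> \<delta>))"
      by (simp add: power_add)
  qed
  moreover have "ribbon \<alpha> * ribbon \<beta> = (\<Sum>\<gamma> | \<alpha> \<le> \<gamma>. \<Sum>\<delta> | \<beta> \<le> \<delta>.
      scale (?s \<gamma> \<delta>) (hh (\<gamma> + \<delta>)))"
    unfolding ribbon_def sum_product
    by (simp add: scale_mult_left scale_mult_right hh_plus mult.commute)
  ultimately show ?thesis
    by (simp add: sum_subtractf)
qed

subsection \<open>Convolutions and the antipode\<close>

lemma lin_plus: "lin f \<Longrightarrow> lin g \<Longrightarrow> lin (\<lambda>x. f x + g x)"
  by (intro linI) (auto simp: lin_add lin_scale scale.scale_right_distrib)

text \<open>Peeling a generator off the coproduct in this way drives the inductions on compositions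
  below.\<close>

lemma conv_Delta_gen:
  "conv F G (Delta_gen k * z)
    = (\<Sum>i\<le>k. conv (\<lambda>x. F (hgen i * x)) (\<lambda>x. G (hgen (k - i) * x)) z)"
proof (rule lin_eqI[of "\<lambda>z. conv F G (Delta_gen k * z)"])
  fix a :: "composition \<times> composition"
  obtain \<alpha> \<beta> where a: "a = (\<alpha>, \<beta>)" by fastforce
  show "conv F G (Delta_gen k * Poly_Mapping.single a 1)
    = (\<Sum>i\<le>k. conv (\<lambda>x. F (hgen i * x)) (\<lambda>x. G (hgen (k - i) * x)) (Poly_Mapping.single a 1))"
    by (simp add: a Delta_gen_mult_single lin_sum[OF lin_conv] conv_single hh_plus flip: hgen_def)
next
  show "lin (\<lambda>z. \<Sum>i\<le>k. conv (\<lambda>x. F (hgen i * x)) (\<lambda>x. G (hgen (k - i) * x)) z)"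
    by (rule linI) (simp_all add: lin_add[OF lin_conv] lin_scale[OF lin_conv]
        sum.distrib scale.scale_sum_right)
qed (auto intro: lin_comp[OF lin_conv] lin_mult_left)

lemma conv_tensor:
  assumes "lin F" "lin G"
  shows "conv F G (tensor x y) = F x * G y"
  using mu_tensor_map[of F G "tensor x y"] by (simp add: tensor_map_tensor assms mu_tensor)

lemma conv_tensor_map:
  assumes "lin F" "lin G"
  shows "conv F G (tensor_map P Q z) = conv (\<lambda>x. F (P x)) (\<lambda>x. G (Q x)) z"
  by (rule lin_eqI[of "\<lambda>z. conv F G (tensor_map P Q z)"])
    (auto intro: lin_comp[OF lin_conv] lin_conv lin_tensor_map
      simp: tensor_map_single conv_single conv_tensor assms tensor_map_def)

lemma conv_mult_left: "conv (\<lambda>x. a * F x) G z = a * conv F G z"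
  by (rule lin_eqI[of _ "\<lambda>z. a * conv F G z"])
    (auto intro: lin_comp[OF lin_mult_left] lin_conv simp: conv_def mult.assoc)

lemma conv_mult_right: "conv F (\<lambda>x. G x * a) z = conv F G z * a"
  by (rule lin_eqI[of _ "\<lambda>z. conv F G z * a"])
    (auto intro: lin_comp[OF lin_mult_right] lin_conv simp: conv_def mult.assoc)

lemma conv_mult_middle: "conv (\<lambda>x. F x * a) G z = conv F (\<lambda>x. a * G x) z"
  by (rule lin_eqI) (auto intro: lin_conv simp: conv_def mult.assoc)

lemma conv_add_right: "conv F (\<lambda>x. G x + G' x) z = conv F G z + conv F G' z"
  by (rule lin_eqI[of _ "\<lambda>z. conv F G z + conv F G' z"])
    (auto intro!: linI simp: lin_add[OF lin_conv] lin_scale[OF lin_conv]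
      lin_add[OF lin_lin_ext] lin_scale[OF lin_lin_ext] conv_def algebra_simps)

lemma conv_sum_right: "conv F (\<lambda>x. \<Sum>i\<in>I. G i x) z = (\<Sum>i\<in>I. conv F (G i) z)"
  by (rule lin_eqI[of _ "\<lambda>z. \<Sum>i\<in>I. conv F (G i) z"])
    (auto intro!: linI simp: lin_add[OF lin_lin_ext] lin_scale[OF lin_lin_ext]
      conv_def sum_distrib_left sum.distrib scale.scale_sum_right scale.scale_right_distrib)

section \<open>The counit as an algebra homomorphism\<close>

lemma counit_simps [simp]:
  "counit 0 = 0" "counit 1 = 1" "counit (x + y) = counit x + counit y"
  "counit (x - y) = counit x - counit y" "counit (scale c x) = c * counit x"
  by (simp_all add: counit_def lookup_add lookup_minus lookup_one)

lemma unit_one [simp]: "unit 1 = 1" and unit_zero [simp]: "unit 0 = 0"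
  by (simp_all add: unit_def)

lemma unit_mult_left [simp]: "unit a * x = scale a x"
  and unit_mult_right [simp]: "x * unit a = scale a x"
  by (simp_all add: unit_def scale_mult_left scale_mult_right)

text \<open>Composing with \<open>unit\<close> makes the scalar-valued counit an operator to which
  \<open>lin\<close> applies, so that checking on the basis suffices.\<close>

lemma unit_counit_mult: "unit (counit (x * y)) = unit (counit x) * unit (counit y)"
proof (rule lin_eqI_hh[of "\<lambda>x. unit (counit (x * y))" "\<lambda>x. unit (counit x) * unit (counit y)"])
  fix \<alpha>
  show "unit (counit (hh \<alpha> * y)) = unit (counit (hh \<alpha>)) * unit (counit y)"
  proof (rule lin_eqI_hh[of "\<lambda>y. unit (counit (hh \<alpha> * y))" "\<lambda>y. unit (counit (hh \<alpha>)) * unit (counit y)"])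
    fix \<beta>
    have "\<alpha> + \<beta> = 0 \<longleftrightarrow> \<alpha> = 0 \<and> \<beta> = 0"
      by (metis add_is_0 csize_eq_0_iff csize_plus)
    then show "unit (counit (hh \<alpha> * hh \<beta>)) = unit (counit (hh \<alpha>)) * unit (counit (hh \<beta>))"
      by (simp add: counit_hh flip: hh_plus)
  qed (auto intro: lin_comp[OF lin_unit_counit] lin_comp[OF lin_mult_left] lin_mult_left
      lin_unit_counit simp del: unit_mult_left unit_mult_right)
qed (auto intro: lin_comp[OF lin_unit_counit] lin_comp[OF lin_mult_right] lin_mult_right
    lin_unit_counit simp del: unit_mult_left unit_mult_right)

lemma counit_unit [simp]: "counit (unit c) = c"
  by (simp add: unit_def)

lemma unit_inject [simp]: "unit a = unit b \<longleftrightarrow> a = b"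
  by (metis counit_unit)

lemma counit_mult: "counit (x * y) = counit x * counit y"
  using unit_counit_mult[of x y] by (metis counit_simps(5) counit_unit unit_mult_left)

lemma counit_hgen: "counit (hgen k) = (if k = 0 then 1 else 0)"
  by (simp add: hgen_def counit_hh)

text \<open>The right counit axiom, with \<open>F\<close> applied. By \<open>Delta_hh_split\<close>
  every term other than \<open>hh \<alpha>\<close> tensor 1 has a nonempty right index, which the
  counit kills.\<close>

lemma conv_unit_counit:
  assumes "lin F"
  shows "conv F (\<lambda>x. unit (counit x)) (Delta f) = F f"
proof (rule lin_eqI_hh[of "\<lambda>f. conv F (\<lambda>x. unit (counit x)) (Delta f)"])
  fix \<alpha>
  obtain r where r: "Delta (hh \<alpha>) = Poly_Mapping.single (\<alpha>, 0) 1 + r"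
    "\<forall>(\<beta>, \<gamma>)\<in>Poly_Mapping.keys r. csize \<beta> + csize \<gamma> = csize \<alpha> \<and> \<gamma> \<noteq> 0"
    using Delta_hh_split by blast
  have "conv F (\<lambda>x. unit (counit x)) r = 0"
    using r(2) by (auto simp: conv_def lin_ext_def counit_hh intro!: sum.neutral)
  then show "conv F (\<lambda>x. unit (counit x)) (Delta (hh \<alpha>)) = F (hh \<alpha>)"
    by (simp add: r(1) lin_add[OF lin_conv] conv_single counit_hh)
qed (auto intro: assms lin_comp[OF lin_conv] lin_Delta)

section \<open>The antipode as an involutive anti-homomorphism\<close>

abbreviation antigen :: "nat \<Rightarrow> ncl" where
  "antigen k \<equiv> antipode (hgen k)"

lemma lin_antipode: "lin antipode"
  and conv_antipode_id: "conv antipode id (Delta x) = unit (counit x)"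
  and conv_id_antipode: "conv id antipode (Delta x) = unit (counit x)"
  using antipode by (auto simp: is_antipode_def mu_tensor_map)

lemma Delta_gen_zero: "Delta_gen 0 = 1"
  by (simp add: Delta_gen_def tensor_hh flip: hh_zero zero_prod_def)

lemma Delta_hgen_all: "Delta (hgen k) = Delta_gen k"
  by (cases "k = 0") (simp_all add: Delta_hgen Delta_gen_zero Delta_one)

lemma conv_Delta_gen_eq:
  assumes "lin F" "lin G"
  shows "conv F G (Delta_gen k) = (\<Sum>i\<le>k. F (hgen i) * G (hgen (k - i)))"
  by (simp add: Delta_gen_def lin_sum[OF lin_conv] conv_tensor assms)

text \<open>The antipode axioms on a generator: the generating series of \<open>hgen\<close> and
  \<open>antigen\<close> are inverse to each other.\<close>

lemma antigen_hgen: "(\<Sum>i\<le>k. antigen i * hgen (k - i)) = (if k = 0 then 1 else 0)"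
  and hgen_antigen: "(\<Sum>i\<le>k. hgen i * antigen (k - i)) = (if k = 0 then 1 else 0)"
  using conv_antipode_id[of "hgen k"] conv_id_antipode[of "hgen k"]
  by (simp_all add: Delta_hgen_all conv_Delta_gen_eq lin_antipode lin_id counit_hgen)

lemma antipode_one [simp]: "antipode 1 = 1"
  using antigen_hgen[of 0] by simp

text \<open>The anti-homomorphism extending \<open>antipode\<close> from the generators is a left convolution
  inverse of the identity, and such an inverse is unique.\<close>

lemma antipode_hh: "antipode (hh \<alpha>) = prod_list (rev (map antigen (parts \<alpha>)))"
proof -
  define U where "U = lin_ext (\<lambda>\<alpha>. prod_list (rev (map antigen (parts \<alpha>))))"
  have U: "lin U" by (simp add: U_def)
  have U_one: "U 1 = 1" by (simp add: U_def flip: hh_zero)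
  have U_gen: "U (hgen k * x) = U x * antigen k" for k x
  proof (rule lin_eqI_hh[of "\<lambda>x. U (hgen k * x)" "\<lambda>x. U x * antigen k"])
    fix \<beta>
    show "U (hgen k * hh \<beta>) = U (hh \<beta>) * antigen k"
      by (cases "k = 0")
        (simp_all add: U_def part_or_empty_def parts_one_part hgen_def flip: hh_plus, simp add: hh_zero)
  qed (auto intro: lin_comp[OF U] lin_mult_left lin_comp[OF lin_mult_right U])
  have "conv U id (Delta (hh \<alpha>)) = unit (counit (hh \<alpha>))" for \<alpha>
  proof (induction \<alpha> rule: composition_induct)
    case zero
    have one: "(1 :: ncl2) = Poly_Mapping.single (0, 0) 1"
      by (simp flip: zero_prod_def)
    show ?case
      by (simp only: hh_zero Delta_one one conv_single) (simp add: hh_zero U_one)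
  next
    case (part k \<beta>)
    \<comment> \<open>After peeling off \<open>hgen k\<close>, the factors \<open>antigen i\<close>
      and \<open>hgen (k - i)\<close> meet in the middle, where their sum vanishes for k >
      0.\<close>
    have "conv U id (Delta (hh (part_or_empty k + \<beta>)))
        = (\<Sum>i\<le>k. conv U (\<lambda>x. antigen i * hgen (k - i) * x) (Delta (hh \<beta>)))"
      by (simp add: Delta_part part(1) conv_Delta_gen U_gen conv_mult_middle mult.assoc)
    also have "\<dots> = conv U (\<lambda>x. (\<Sum>i\<le>k. antigen i * hgen (k - i)) * x) (Delta (hh \<beta>))"
      by (simp add: conv_sum_right sum_distrib_right)
    also have "\<dots> = 0"
      using part(1) by (subst antigen_hgen) (simp add: conv_def lin_ext_def case_prod_beta)
    also have "0 = unit (counit (hh (part_or_empty k + \<beta>)))"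
      using part(1) by (simp add: hh_plus unit_counit_mult counit_hgen flip: hgen_def)
    finally show ?case .
  qed
  then have inv: "conv U id (Delta x) = unit (counit x)" for x
    using lin_comp[OF lin_conv lin_Delta] lin_unit_counit
    by (rule lin_eqI_hh[of "\<lambda>x. conv U id (Delta x)", rotated 2])
  have diff: "conv (\<lambda>x. antipode x - U x) id z = conv antipode id z - conv U id z" for z
    by (rule lin_eqI[of _ "\<lambda>z. conv antipode id z - conv U id z"])
      (auto intro: lin_diff lin_conv simp: conv_def algebra_simps)
  have "antipode x - U x = 0" for x
    by (rule left_convolution_zero[of "\<lambda>x. antipode x - U x"])
      (auto intro: lin_diff lin_antipode U simp: diff conv_antipode_id inv)
  then have "antipode (hh \<alpha>) = U (hh \<alpha>)" by (metis eq_iff_diff_eq_0)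
  then show ?thesis by (simp add: U_def)
qed

lemma antipode_mult: "antipode (x * y) = antipode y * antipode x"
proof (rule lin_eqI_hh[of "\<lambda>x. antipode (x * y)" "\<lambda>x. antipode y * antipode x"])
  fix \<alpha>
  show "antipode (hh \<alpha> * y) = antipode y * antipode (hh \<alpha>)"
    by (rule lin_eqI_hh[of "\<lambda>y. antipode (hh \<alpha> * y)" "\<lambda>y. antipode y * antipode (hh \<alpha>)"])
      (auto intro: lin_comp[OF lin_antipode] lin_comp[OF lin_mult_right lin_antipode] lin_mult_left
        simp: antipode_hh simp flip: hh_plus)
qed (auto intro: lin_comp[OF lin_antipode] lin_comp[OF lin_mult_left lin_antipode] lin_mult_right)

lemma left_right_inverse_unique: "a * b = 1 \<Longrightarrow> b * c = 1 \<Longrightarrow> a = (c :: 'a::monoid_mult)"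
  by (metis mult.assoc mult.left_neutral mult.right_neutral)

lemma fps_hgen_antigen: "Abs_fps hgen * Abs_fps antigen = 1"
  by (rule fps_ext) (simp add: fps_mult_nth atLeast0AtMost hgen_antigen)

text \<open>Applying the anti-multiplicative antipode to \<open>antigen_hgen\<close> shows that the
  series of \<open>antipode (antigen k)\<close> is a right inverse of the series of
  \<open>antigen\<close>, while the series of \<open>hgen\<close> is a left inverse.\<close>

lemma antipode_antigen: "antipode (antigen k) = hgen k"
proof -
  have "Abs_fps antigen * Abs_fps (\<lambda>k. antipode (antigen k)) = 1"
  proof (rule fps_ext)
    fix k
    have "(\<Sum>i\<le>k. antigen i * antipode (antigen (k - i)))
        = (\<Sum>i\<le>k. antipode (antigen i * hgen (k - i)))"
      unfolding antipode_mult
      by (rule sum.reindex_bij_witness[of _ "\<lambda>i. k - i" "\<lambda>i. k - i"]) auto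
    also have "\<dots> = antipode (if k = 0 then 1 else 0)"
      by (simp only: antigen_hgen flip: lin_sum[OF lin_antipode])
    finally show "fps_nth (Abs_fps antigen * Abs_fps (\<lambda>k. antipode (antigen k))) k = fps_nth 1 k"
      by (simp add: fps_mult_nth atLeast0AtMost lin_zero[OF lin_antipode])
  qed
  with fps_hgen_antigen have "Abs_fps hgen = Abs_fps (\<lambda>k. antipode (antigen k))"
    by (rule left_right_inverse_unique)
  from arg_cong[OF this, of "\<lambda>f. fps_nth f k"] show ?thesis by simp
qed

lemma antipode_antipode: "antipode (antipode x) = x"
proof (rule lin_eqI_hh[of "\<lambda>x. antipode (antipode x)" "\<lambda>x. x"])
  fix \<alpha>
  show "antipode (antipode (hh \<alpha>)) = hh \<alpha>"
  proof (induction \<alpha> rule: composition_induct)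
    case (part k \<beta>)
    then show ?case
      by (simp add: hh_plus antipode_mult antipode_antigen flip: hgen_def)
  qed (simp add: hh_zero)
qed (auto intro: lin_comp lin_antipode lin_id)

section \<open>Compatibility of the antipode with the coproduct\<close>

lemma tensor_mult: "tensor a b * tensor c d = tensor (a * c) (b * d)"
proof -
  have 1: "tensor (hh \<alpha>) (hh \<beta>) * tensor (hh \<gamma>) d = tensor (hh \<alpha> * hh \<gamma>) (hh \<beta> * d)" for \<alpha> \<beta> \<gamma>
    by (rule lin_eqI_hh[of "\<lambda>d. tensor (hh \<alpha>) (hh \<beta>) * tensor (hh \<gamma>) d"])
      (auto intro!: lin_comp[OF lin_mult_left] lin_comp[OF lin_tensor_right] lin_mult_left
         lin_tensor_right simp: tensor_hh mult_single simp flip: hh_plus)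
  have 2: "tensor (hh \<alpha>) (hh \<beta>) * tensor c d = tensor (hh \<alpha> * c) (hh \<beta> * d)" for \<alpha> \<beta>
    by (rule lin_eqI_hh[of "\<lambda>c. tensor (hh \<alpha>) (hh \<beta>) * tensor c d"])
      (auto intro!: lin_comp[OF lin_mult_left] lin_comp[OF lin_tensor_left] lin_mult_left
         lin_tensor_left simp: 1)
  have 3: "tensor (hh \<alpha>) b * tensor c d = tensor (hh \<alpha> * c) (b * d)" for \<alpha>
    by (rule lin_eqI_hh[of "\<lambda>b. tensor (hh \<alpha>) b * tensor c d"])
      (auto intro!: lin_comp[OF lin_mult_right] lin_comp[OF lin_tensor_right] lin_mult_right
         lin_tensor_right simp: 2)
  show ?thesis
    by (rule lin_eqI_hh[of "\<lambda>a. tensor a b * tensor c d"])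
      (auto intro!: lin_comp[OF lin_mult_right] lin_comp[OF lin_tensor_left] lin_mult_right
         lin_tensor_left simp: 3)
qed

lemma tensor_one: "tensor 1 1 = 1"
  by (simp add: tensor_hh flip: hh_zero zero_prod_def)

lemma tensor_map_antipode_mult:
  "tensor_map antipode antipode (z * w)
    = tensor_map antipode antipode w * tensor_map antipode antipode z"
proof -
  let ?T = "tensor_map antipode antipode"
  have 1: "?T (Poly_Mapping.single a 1 * w) = ?T w * ?T (Poly_Mapping.single a 1)" for a
  proof (rule lin_eqI[of "\<lambda>w. ?T (Poly_Mapping.single a 1 * w)"])
    fix b :: "composition \<times> composition"
    obtain \<alpha> \<beta> \<gamma> \<delta> where "a = (\<alpha>, \<beta>)" "b = (\<gamma>, \<delta>)" by fastforce
    then show "?T (Poly_Mapping.single a 1 * Poly_Mapping.single b 1)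
        = ?T (Poly_Mapping.single b 1) * ?T (Poly_Mapping.single a 1)"
      by (simp add: mult_single tensor_map_single hh_plus antipode_mult tensor_mult)
  qed (auto intro: lin_comp[OF lin_tensor_map] lin_comp[OF lin_mult_right] lin_mult_left lin_tensor_map)
  show ?thesis
    by (rule lin_eqI[of "\<lambda>z. ?T (z * w)"])
      (auto intro: lin_comp[OF lin_tensor_map] lin_comp[OF lin_mult_left] lin_mult_right
        lin_tensor_map simp: 1)
qed

text \<open>The series \<open>\<Sum>\<^sub>k h\<^sub>k t\<^sup>k\<close> is group-like, hence so is its inverse \<open>\<Sum>\<^sub>k S(h\<^sub>k) t\<^sup>k\<close>.\<close>

lemma Delta_antigen: "Delta (antigen k) = (\<Sum>i\<le>k. tensor (antigen i) (antigen (k - i)))"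
proof -
  \<comment> \<open>\<open>L\<close> and \<open>R\<close> place a series in the left and right
    tensor factor, where the two commute. The product \<open>L hgen * R hgen\<close> is the
    coproduct of the series of generators; comparing its left inverse
    \<open>L antigen * R antigen\<close> with a right inverse gives the claim.\<close>
  define L where "L f = Abs_fps (\<lambda>k. tensor (f k) 1)" for f :: "nat \<Rightarrow> ncl"
  define R where "R f = Abs_fps (\<lambda>k. tensor 1 (f k))" for f :: "nat \<Rightarrow> ncl"
  have LR: "fps_nth (L f * R g) k = (\<Sum>i\<le>k. tensor (f i) (g (k - i)))" for f g k
    by (simp add: L_def R_def fps_mult_nth atLeast0AtMost tensor_mult)
  have comm: "L f * R g = R g * L f" for f g
  proof (rule fps_ext)
    fix k
    show "fps_nth (L f * R g) k = fps_nth (R g * L f) k"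
      unfolding LR
      by (simp add: L_def R_def fps_mult_nth atLeast0AtMost tensor_mult)
        (rule sum.reindex_bij_witness[of _ "\<lambda>i. k - i" "\<lambda>i. k - i"]; auto)
  qed
  have inv: "L antigen * L hgen = 1" "R antigen * R hgen = 1"
    by (rule fps_ext, simp add: L_def R_def fps_mult_nth atLeast0AtMost tensor_mult antigen_hgen
        tensor_one lin_zero[OF lin_tensor_left] lin_zero[OF lin_tensor_right]
        flip: lin_sum[OF lin_tensor_left] lin_sum[OF lin_tensor_right])+
  have "(R antigen * L antigen) * (L hgen * R hgen) = R antigen * (L antigen * L hgen) * R hgen"
    by (simp only: mult.assoc)
  also have "\<dots> = 1" by (simp add: inv)
  finally have left: "(L antigen * R antigen) * (L hgen * R hgen) = 1"
    by (simp only: comm)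
  have right: "(L hgen * R hgen) * Abs_fps (\<lambda>k. Delta (antigen k)) = 1"
  proof (rule fps_ext)
    fix k
    have "fps_nth (L hgen * R hgen * Abs_fps (\<lambda>k. Delta (antigen k))) k
        = (\<Sum>i\<le>k. Delta (hgen i * antigen (k - i)))"
      by (simp add: fps_mult_nth[of "L hgen * R hgen"] LR atLeast0AtMost Delta_mult Delta_hgen_all
          flip: Delta_gen_def)
    also have "\<dots> = Delta (if k = 0 then 1 else 0)"
      by (simp only: hgen_antigen flip: lin_sum[OF lin_Delta])
    finally show "fps_nth (L hgen * R hgen * Abs_fps (\<lambda>k. Delta (antigen k))) k = fps_nth 1 k"
      by (simp add: Delta_one lin_zero[OF lin_Delta])
  qed
  show ?thesis
    using arg_cong[OF left_right_inverse_unique[OF left right], of "\<lambda>f. fps_nth f k"] by (simp add: LR)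
qed

text \<open>Both sides reverse products, so generators suffice, and these are covered by
  \<open>Delta_antigen\<close>. Cocommutativity is why no flip of the factors appears.\<close>

lemma Delta_antipode: "Delta (antipode x) = tensor_map antipode antipode (Delta x)"
proof (rule lin_eqI_hh[of "\<lambda>x. Delta (antipode x)"])
  fix \<alpha>
  have gen: "tensor_map antipode antipode (Delta_gen k) = Delta (antigen k)" for k
    by (simp add: Delta_gen_def lin_sum[OF lin_tensor_map] tensor_map_tensor lin_antipode Delta_antigen)
  show "Delta (antipode (hh \<alpha>)) = tensor_map antipode antipode (Delta (hh \<alpha>))"
  proof (induction \<alpha> rule: composition_induct)
    case zero
    then show ?case
      by (simp add: hh_zero Delta_one tensor_map_tensor lin_antipode flip: tensor_one)
  next
    case (part k \<beta>)
    then show ?case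
      by (simp add: hh_plus antipode_mult Delta_mult tensor_map_antipode_mult Delta_hgen_all gen
          flip: hgen_def)
  qed
qed (auto intro: lin_comp[OF lin_Delta] lin_comp[OF lin_tensor_map] lin_antipode lin_Delta)

text \<open>In Sweedler notation, \<open>f\<^sub>1 S(f\<^sub>2) G(f\<^sub>3) = G(f)\<close>.\<close>

lemma conv_id_conv_antipode:
  assumes "lin G"
  shows "conv id (\<lambda>x. conv antipode G (Delta x)) (Delta f) = G f"
proof (rule lin_eqI_hh[of "\<lambda>f. conv id (\<lambda>x. conv antipode G (Delta x)) (Delta f)"])
  fix \<alpha>
  show "conv id (\<lambda>x. conv antipode G (Delta x)) (Delta (hh \<alpha>)) = G (hh \<alpha>)"
    using assms
  \<comment> \<open>\<open>G\<close> must vary: peeling off a generator replaces it by maps of the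
    form \<open>\<lambda>x. antigen j * G (hgen l * x)\<close>.\<close>
  proof (induction \<alpha> arbitrary: G rule: composition_induct)
    case zero
    have "conv antipode G (Delta 1) = G 1"
      using conv_tensor[OF lin_antipode zero, of 1 1] by (simp add: Delta_one tensor_one)
    then show ?case
      using conv_tensor[OF lin_id(2), of "\<lambda>x. conv antipode G (Delta x)" 1 1]
      by (simp add: hh_zero Delta_one tensor_one lin_comp[OF lin_conv lin_Delta] id_def)
  next
    case (part k \<beta>)
    let ?W = "\<lambda>G x. conv antipode G (Delta x)"
    have W: "?W G (hgen l * x) = (\<Sum>j\<le>l. ?W (\<lambda>x. antigen j * G (hgen (l - j) * x)) x)" for l x
      by (simp add: Delta_mult Delta_hgen_all conv_Delta_gen antipode_mult conv_mult_middle)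
    have lin: "lin (\<lambda>x. a * G (b * x))" for a b
      using lin_comp[OF lin_mult_left lin_comp[OF part.prems lin_mult_left]] .
    have "conv id (?W G) (Delta (hh (part_or_empty k + \<beta>)))
      = (\<Sum>i\<le>k. hgen i * (\<Sum>j\<le>k-i. conv id (?W (\<lambda>x. antigen j * G (hgen (k - i - j) * x))) (Delta (hh \<beta>))))"
      by (simp add: Delta_part part.hyps(1) conv_Delta_gen W conv_mult_left[of _ "\<lambda>x. x"] conv_sum_right
          sum_distrib_left id_def)
    also have "\<dots> = (\<Sum>i\<le>k. hgen i * (\<Sum>j\<le>k-i. antigen j * G (hgen (k - i - j) * hh \<beta>)))"
      by (simp add: part.IH[OF lin])
    \<comment> \<open>Read as a coefficient of a triple product of series, the double sum collapses
      because the first two series are inverse.\<close>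
    also have "\<dots> = fps_nth (Abs_fps hgen * (Abs_fps antigen * Abs_fps (\<lambda>l. G (hgen l * hh \<beta>)))) k"
      by (simp add: fps_mult_nth atLeast0AtMost)
    also have "\<dots> = G (hgen k * hh \<beta>)"
      by (simp add: fps_hgen_antigen flip: mult.assoc)
    finally show ?case by (simp add: hh_plus hgen_def id_def)
  qed
qed (auto intro: lin_comp[OF lin_conv] lin_Delta assms)

subsection \<open>The bar involution and \<open>q\<close>-analogs\<close>

lemma bar_conv: "bar V f = conv id (\<lambda>x. V (antipode x)) (Delta f)"
  by (simp add: bar_def mu_tensor_map o_def)

lemma lin_bar: "lin (bar V)"
  using lin_comp[OF lin_conv lin_Delta] by (simp add: bar_conv[abs_def])

text \<open>Since the antipode is an involution compatible with \<open>Delta\<close>,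
  \<open>bar V\<close> after the antipode is the convolution of the antipode with \<open>V\<close>.
  Convolving with the identity on the left then cancels the antipode.\<close>

lemma bar_bar:
  assumes "lin V"
  shows "bar (bar V) = V"
proof
  fix f
  have "bar V (antipode x) = conv antipode V (Delta x)" for x
    by (simp add: bar_conv Delta_antipode conv_tensor_map lin_id lin_comp[OF assms lin_antipode]
        antipode_antipode)
  then show "bar (bar V) f = V f"
    using conv_id_conv_antipode[OF assms] by (simp add: bar_conv[of "bar V"])
qed

text \<open>Left linearity on the augmentation ideal, extended to all \<open>y\<close> by splitting off its counit.\<close>

definition quasi_left_linear :: "(ncl \<Rightarrow> ncl) \<Rightarrow> bool" where
  "quasi_left_linear V \<longleftrightarrow> lin V \<and>
    (\<forall>x y. V (x * y) = x * V y + scale (counit y) (V x - x * V 1))"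

text \<open>Pulling \<open>V\<close> through each product leaves a correction weighted by the counit
  of the right factor; as \<open>G\<close> preserves the counit, \<open>conv_unit_counit\<close>
  sums these corrections.\<close>

lemma quasi_left_linear_conv:
  assumes V: "quasi_left_linear V" and G: "lin G" "\<And>x. counit (G x) = counit x"
  shows "V (conv id G (Delta f)) = conv id (\<lambda>x. V (G x)) (Delta f) + V f - f * V 1"
proof -
  have lin: "lin V" using V by (simp add: quasi_left_linear_def)
  have D: "lin (\<lambda>x. V x - x * V 1)"
    by (intro lin_diff lin lin_mult_right)
  have "V (conv id G z) = conv id (\<lambda>x. V (G x)) z + conv (\<lambda>x. V x - x * V 1) (\<lambda>x. unit (counit x)) z" for z
  proof (rule lin_eqI[of "\<lambda>z. V (conv id G z)"])
    fix a :: "composition \<times> composition"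
    obtain \<alpha> \<beta> where "a = (\<alpha>, \<beta>)" by fastforce
    then show "V (conv id G (Poly_Mapping.single a 1)) = conv id (\<lambda>x. V (G x)) (Poly_Mapping.single a 1)
        + conv (\<lambda>x. V x - x * V 1) (\<lambda>x. unit (counit x)) (Poly_Mapping.single a 1)"
      using V by (simp add: conv_single quasi_left_linear_def G)
  qed (auto intro: lin_comp[OF lin] lin_conv linI simp: lin_add[OF lin_conv] lin_scale[OF lin_conv]
        scale.scale_right_distrib)
  then show ?thesis
    by (simp add: conv_unit_counit[OF D])
qed

lemma counit_antipode: "counit (antipode x) = counit x"
proof -
  have "unit (counit (antipode x)) = unit (counit x)"
  proof (rule lin_eqI_hh[of "\<lambda>x. unit (counit (antipode x))"])
    fix \<alpha>
    show "unit (counit (antipode (hh \<alpha>))) = unit (counit (hh \<alpha>))"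
    proof (induction \<alpha> rule: composition_induct)
      case (part k \<beta>)
      \<comment> \<open>Under the counit only the summand with i = k of \<open>antigen_hgen\<close>
        survives.\<close>
      have "unit (counit (antigen k)) = 0"
        using arg_cong[OF antigen_hgen[of k], of "\<lambda>x. unit (counit x)"] part(1)
        by (simp add: lin_sum[OF lin_unit_counit] unit_counit_mult counit_hgen if_distrib[of unit]
            mult_delta_right del: unit_mult_right cong: if_cong)
      then show ?case
        using part by (simp add: hh_plus antipode_mult unit_counit_mult counit_hgen flip: hgen_def)
    qed (simp add: hh_zero)
  qed (auto intro: lin_comp[OF lin_unit_counit] lin_unit_counit lin_antipode)
  then show ?thesis by simp
qed

text \<open>Take the antipode for \<open>G\<close> in \<open>quasi_left_linear_conv\<close>: the
  left side becomes \<open>V\<close> of a scalar, and the equation is solved for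
  \<open>bar V f\<close>.\<close>

lemma bar_quasi_left_linear:
  assumes "quasi_left_linear V"
  shows "bar V f = f * V 1 + scale (counit f) (V 1) - V f"
proof -
  have "V (unit (counit f)) = scale (counit f) (V 1)"
    using assms by (simp add: unit_def quasi_left_linear_def lin_scale)
  then show ?thesis
    using quasi_left_linear_conv[OF assms lin_antipode counit_antipode, of f]
    by (simp add: conv_id_antipode bar_conv algebra_simps)
qed

text \<open>This allows \<open>quasi_left_linear_conv\<close> to be applied to \<open>bar V\<close>
  as well.\<close>

lemma quasi_left_linear_bar:
  assumes "quasi_left_linear V"
  shows "quasi_left_linear (bar V)" "bar V 1 = V 1"
proof -
  have V: "V (x * y) = x * V y + scale (counit y) (V x - x * V 1)" for x y
    using assms by (simp add: quasi_left_linear_def)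
  show "bar V 1 = V 1"
    using bar_quasi_left_linear[OF assms, of 1] by simp
  then show "quasi_left_linear (bar V)"
    by (simp add: quasi_left_linear_def lin_bar)
      (simp add: bar_quasi_left_linear[OF assms] V counit_mult mult.assoc scale_mult_left scale_mult_right
        scale.scale_right_distrib scale.scale_right_diff_distrib algebra_simps)
qed

lemma lin_Rq: "lin Rq" and Rq_one [simp]: "Rq 1 = 1"
  by (simp_all add: Rq_def flip: hh_zero)

lemma counit_Rq: "counit (Rq x) = counit x"
proof -
  have "unit (counit (Rq x)) = unit (counit x)"
    by (rule lin_eqI_hh[of "\<lambda>x. unit (counit (Rq x))"])
      (auto intro: lin_comp[OF lin_unit_counit] lin_unit_counit lin_Rq simp: Rq_def counit_hh)
  then show ?thesis by simp
qed

lemma q_analog_quasi_left_linear: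
  assumes "quasi_left_linear V"
  shows "q_analog V f = Rq f * V 1 + V f - V (Rq f)"
proof -
  let ?C = "bar V"
  have V: "lin V" using assms by (simp add: quasi_left_linear_def)
  note C = quasi_left_linear_bar[OF assms]
  \<comment> \<open>Here \<open>G\<close> is \<open>Rq\<close> after the antipode. The first summand
    is itself a bar, so the outer bar of the q-analog will undo it.\<close>
  have "?C (bar Rq x) = bar (\<lambda>x. ?C (Rq x)) x + (?C x - x * V 1)" for x
    using quasi_left_linear_conv[OF C(1), of "\<lambda>x. Rq (antipode x)" x]
    by (simp add: bar_conv[of Rq] bar_conv[of "\<lambda>x. ?C (Rq x)"] counit_Rq counit_antipode C(2)
        lin_comp[OF lin_Rq lin_antipode] algebra_simps)
  \<comment> \<open>The subtraction is written as a sum with a right factor \<open>- V 1\<close> to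
    fit \<open>conv_add_right\<close> and \<open>conv_mult_right\<close>.\<close>
  then have "q_analog V f = bar (\<lambda>x. bar (\<lambda>x. ?C (Rq x)) x + (?C x + x * (- V 1))) f"
    by (simp add: q_analog_def o_def)
  also have "\<dots> = bar (bar (\<lambda>x. ?C (Rq x))) f + (bar ?C f + conv id antipode (Delta f) * (- V 1))"
    by (simp only: bar_conv[of "\<lambda>x. bar _ x + _ x"] conv_add_right conv_mult_right)
       (simp add: bar_conv[of "bar _"])
  also have "\<dots> = ?C (Rq f) + (V f - scale (counit f) (V 1))"
    by (simp add: bar_bar V lin_comp[OF lin_bar lin_Rq] conv_id_antipode)
  finally show ?thesis
    by (simp add: bar_quasi_left_linear[OF assms] counit_Rq)
qed

subsection \<open>The operator appending a part\<close>

lemma counit_ribbon: "counit (ribbon \<alpha>) = (if \<alpha> = 0 then 1 else 0)"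
proof (cases "\<alpha> = 0")
  case False
  have "unit (counit (ribbon \<alpha>)) = 0"
    unfolding ribbon_def lin_sum[OF lin_unit_counit] using False coarser_nonzero
    by (auto intro!: sum.neutral simp: counit_hh)
  then show ?thesis
    using False unit_inject[of _ 0] by simp
qed simp

text \<open>By bilinearity it suffices to test ribbons. Appending \<alpha> after a nonempty \<gamma>
  affects neither the concatenation nor the merging of \<beta> with \<gamma>, so
  \<open>ribbon_mult\<close> applies on both sides; for empty \<gamma> the correction term makes up
  the difference.\<close>

lemma quasi_left_linear_append_op:
  assumes "\<alpha> \<noteq> 0"
  shows "quasi_left_linear (append_op \<alpha>)"
proof -
  let ?A = "append_op \<alpha>"
  \<comment> \<open>Using \<open>unit (counit y)\<close> as a factor reduces linearity in y to
    \<open>lin_unit_counit\<close>.\<close>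
  let ?D = "\<lambda>x y. unit (counit y) * (?A x - x * ?A 1)"
  have A: "lin ?A" by (rule lin_append_op)
  have 1: "?A 1 = ribbon \<alpha>" using append_op_ribbon[of \<alpha> 0] by simp
  have linD: "lin (\<lambda>x. ?D x y)" "lin (\<lambda>y. ?D x y)" for x y
    by (auto intro!: lin_comp[OF lin_mult_left] lin_comp[OF lin_mult_right] lin_diff A
        lin_unit_counit lin_mult_right simp del: unit_mult_left)
  have eq: "?A (ribbon \<beta> * ribbon \<gamma>) = ribbon \<beta> * ?A (ribbon \<gamma>) + ?D (ribbon \<beta>) (ribbon \<gamma>)" for \<beta> \<gamma>
  proof (cases "\<beta> = 0 \<or> \<gamma> = 0")
    case False
    then have "\<gamma> + \<alpha> \<noteq> 0" by (simp flip: csize_eq_0_iff)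
    moreover have "near_concat \<beta> \<gamma> + \<alpha> = near_concat \<beta> (\<gamma> + \<alpha>)"
      using False assms \<open>\<gamma> + \<alpha> \<noteq> 0\<close> near_concat_nonzero[of \<beta> \<gamma>]
      by (intro composition_eqI)
        (auto simp: descents_plus descents_near_concat image_Un image_image add.assoc)
    ultimately show ?thesis
      using False by (simp add: ribbon_mult lin_add[OF A] append_op_ribbon counit_ribbon add.assoc)
  qed (auto simp: 1 counit_ribbon append_op_ribbon)
  have "?A (x * y) = x * ?A y + ?D x y" for x y
  proof (rule lin_eqI_ribbon[of "\<lambda>x. ?A (x * y)" "\<lambda>x. x * ?A y + ?D x y"])
    fix \<beta>
    show "?A (ribbon \<beta> * y) = ribbon \<beta> * ?A y + ?D (ribbon \<beta>) y"
      by (rule lin_eqI_ribbon[of "\<lambda>y. ?A (ribbon \<beta> * y)" "\<lambda>y. ribbon \<beta> * ?A y + ?D (ribbon \<beta>) y"])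
        (intro eq lin_plus linD lin_comp[OF A] lin_comp[OF lin_mult_left] A lin_mult_left)+
  qed (intro lin_plus linD lin_comp[OF A] lin_mult_right)+
  then show ?thesis
    by (simp add: quasi_left_linear_def A)
qed

lemma Rq_ribbon: "Rq (ribbon \<alpha>) = scale (qq ^ csize \<alpha>) (ribbon \<alpha>)"
  by (simp add: ribbon_def lin_sum[OF lin_Rq] lin_scale[OF lin_Rq] scale.scale_sum_right,
      rule sum.cong) (auto simp: Rq_def less_eq_composition_def mult.commute)

text \<open>In the collapsed formula, \<open>Rq f * V 1\<close> is a scaled product of two ribbons;
  subtracting \<open>V (Rq f)\<close> removes its concatenation term and leaves the merged
  one.\<close>

lemma q_analog_append_ribbon:
  assumes "\<alpha> \<noteq> 0" "\<beta> \<noteq> 0"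
  shows "q_analog (append_op \<alpha>) (ribbon \<beta>)
    = ribbon (\<beta> + \<alpha>) + scale (qq ^ csize \<beta>) (ribbon (near_concat \<beta> \<alpha>))"
  using append_op_ribbon[of \<alpha> 0] assms
  by (simp add: q_analog_quasi_left_linear quasi_left_linear_append_op Rq_ribbon append_op_ribbon
      lin_scale[OF lin_append_op] scale_mult_left ribbon_mult scale.scale_right_distrib)

lemma q_analog_append_one: "\<alpha> \<noteq> 0 \<Longrightarrow> q_analog (append_op \<alpha>) 1 = ribbon \<alpha>"
  using append_op_ribbon[of \<alpha> 0]
  by (simp add: q_analog_quasi_left_linear quasi_left_linear_append_op)

section \<open>The recursion for \<open>Hq\<close>\<close>

lemma common_descents_sum_complement:
  "csize \<alpha> = csize \<beta> \<Longrightarrow> common_descents_sum \<alpha> (complement \<beta>) = \<Sum>(descents \<alpha> - descents \<beta>)"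
  using descents_subset[of \<alpha>]
  by (auto simp: common_descents_sum_def descents_complement intro!: arg_cong[of _ _ "\<lambda>A. \<Sum>A"])

lemma Hq_alt: "Hq \<alpha> = (\<Sum>\<beta> | \<alpha> \<le> \<beta>. scale (qq ^ (\<Sum>(descents \<alpha> - descents \<beta>))) (ribbon \<beta>))"
  unfolding Hq_def
  by (rule sum.cong) (auto simp: less_eq_composition_def common_descents_sum_complement)

lemma Hq_plus_one_part:
  assumes "m > 0"
  shows "Hq (\<alpha> + one_part m) = q_analog (append_op (one_part m)) (Hq \<alpha>)"
proof (cases "\<alpha> = 0")
  \<comment> \<open>For empty \<alpha> concatenation and merging coincide, so a two-term recursion
    would count the same ribbon twice.\<close>
  case True
  then show ?thesis
    using assms by (simp add: Hq_alt coarser_zero coarser_one_part q_analog_append_one)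
next
  case False
  let ?p = "one_part m" and ?Q = "q_analog (append_op (one_part m))"
  have Q: "lin ?Q" by (simp add: q_analog_def lin_bar)
  have "Hq (\<alpha> + ?p) = (\<Sum>\<beta> | \<alpha> \<le> \<beta>.
      scale (qq ^ (\<Sum>(descents (\<alpha> + ?p) - descents (\<beta> + ?p)))) (ribbon (\<beta> + ?p)) +
      scale (qq ^ (\<Sum>(descents (\<alpha> + ?p) - descents (near_concat \<beta> ?p)))) (ribbon (near_concat \<beta> ?p)))"
    using assms False by (simp add: Hq_alt sum_coarser_plus coarser_one_part)
  also have "\<dots> = (\<Sum>\<beta> | \<alpha> \<le> \<beta>. ?Q (scale (qq ^ (\<Sum>(descents \<alpha> - descents \<beta>))) (ribbon \<beta>)))"
  proof (intro sum.cong refl)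
    fix \<beta> assume "\<beta> \<in> {\<beta>. \<alpha> \<le> \<beta>}"
    then have \<beta>: "\<beta> \<noteq> 0" "csize \<beta> = csize \<alpha>" "csize \<alpha> \<notin> descents \<beta>" "csize \<alpha> \<notin> descents \<alpha>"
      using False coarser_nonzero descents_upper[of "csize \<alpha>" \<beta>] descents_upper[of "csize \<alpha>" \<alpha>]
      by (auto simp: less_eq_composition_def)
    \<comment> \<open>Only merging loses the descent \<open>csize \<alpha>\<close>, which equals
      \<open>csize \<beta>\<close>; it supplies the extra power of q in
      \<open>q_analog_append_ribbon\<close>.\<close>
    have "descents (\<alpha> + ?p) - descents (\<beta> + ?p) = descents \<alpha> - descents \<beta>"
      "descents (\<alpha> + ?p) - descents (near_concat \<beta> ?p) = insert (csize \<alpha>) (descents \<alpha> - descents \<beta>)"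
      using \<beta> False assms by (auto simp: descents_plus descents_near_concat)
    then show "scale (qq ^ (\<Sum>(descents (\<alpha> + ?p) - descents (\<beta> + ?p)))) (ribbon (\<beta> + ?p)) +
        scale (qq ^ (\<Sum>(descents (\<alpha> + ?p) - descents (near_concat \<beta> ?p)))) (ribbon (near_concat \<beta> ?p))
      = ?Q (scale (qq ^ (\<Sum>(descents \<alpha> - descents \<beta>))) (ribbon \<beta>))"
      using \<beta> assms by (simp add: lin_scale[OF Q] q_analog_append_ribbon scale.scale_right_distrib
          power_add mult.commute)
  qed
  finally show ?thesis by (simp add: Hq_alt lin_sum[OF Q])
qed

theorem proposition7:
  fixes \<alpha> :: composition
  assumes "\<alpha> \<noteq> 0"
  shows "Hq \<alpha> = fold (\<lambda>m. q_analog (append_op (one_part m))) (parts \<alpha>) 1"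
proof -
  \<comment> \<open>\<open>fold\<close> applies the operator of the first part first, so the last
    part gives the outermost operator; induction from the right end matches
    \<open>Hq_plus_one_part\<close>.\<close>
  have "Hq (Composition xs) = fold (\<lambda>m. q_analog (append_op (one_part m))) xs 1" if "0 \<notin> set xs" for xs
    using that
  proof (induction xs rule: rev_induct)
    case Nil
    then show ?case
      by (simp add: Hq_alt coarser_zero flip: zero_composition_def)
  next
    case (snoc m xs)
    then have m: "m > 0" "0 \<notin> set xs" by auto
    then have "Composition (xs @ [m]) = Composition xs + one_part m"
      by (simp add: plus_composition_def parts_Composition parts_one_part)
    then show ?case
      using snoc.IH m by (simp add: Hq_plus_one_part)
  qed
  from this[OF parts_nonzero[of \<alpha>]] show ?thesis
    by (simp add: parts_inverse)
qed

end
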